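(* If $K$ is a semi-equivelar map of type $(3^4,4^2)$ with $12$ vertices on a surface of Euler characteristic $-2$, then $K$ is isomorphic to one of $KO_{1[(3^4,4^2)]}$, $KO_{2[(3^4,4^2)]}$ or $KNO_{[(3^4,4^2)]}$. The maps $KO_{1[(3^4,4^2)]}$ and $KO_{2[(3^4,4^2)]}$ are orientable and $KNO_{[(3^4,4^2)]}$ is non-orientable.
   Context: A surface is a compact connected 2-dimensional manifold without boundary. A map on a surface $S$ is a finite (combinatorial) polyhedral 2-complex $X$ whose geometric carrier is $S$: a finite vertex set $V(X)$, edges, and 2-faces that are polygons ($n$-gons, $n\ge 3$, each identified with a cycle of $n$ distinct vertices), such that any two distinct faces meet in the empty set, a single common vertex, or a single common edge. The faces containing a vertex $v$ are arranged cyclically around $v$. The vertex $v$ has face sequence $(a_1^{n_1},\dots,a_m^{n_m})$ if, going around $v$, one meets $n_1$ consecutive $a_1$-gons, then $n_2$ consecutive $a_2$-gons, ..., then $n_m$ consecutive $a_m$-gons (up to cyclic rotation and reversal). A map is semi-equivelar of type $(a_1^{n_1},\dots,a_m^{n_m})$ if all its vertices have this face sequence. A map is orientable (non-orientable) if its underlying surface is. Two maps are isomorphic if there is a bijection between their vertex sets carrying faces (as cycles) onto faces. The following maps have vertex set $\{0,1,\dots,11\}$; $[a,b,c]$ is a triangle and $[a,b,c,d]$ is the quadrilateral with boundary cycle $a\,b\,c\,d\,a$. $KO_{1[(3^4,4^2)]}$ has faces: $[0,1,8,7]$, $[0,5,6,7]$, $[5,6,11,2]$, $[1,8,10,3]$,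 $[3,10,9,4]$, $[2,11,9,4]$, $[0,4,5]$, $[0,1,2]$, $[0,3,4]$, $[0,2,3]$, $[6,7,9]$, $[7,8,11]$, $[7,9,10]$, $[7,10,11]$, $[2,3,5]$, $[1,3,5]$, $[6,10,11]$, $[6,8,10]$, $[1,4,5]$, $[1,2,4]$, $[6,8,9]$, $[8,9,11]$. $KO_{2[(3^4,4^2)]}$ has faces: $[0,1,8,7]$, $[0,5,6,7]$, $[5,6,11,3]$, $[1,8,10,4]$, $[4,10,9,2]$, $[3,11,9,2]$, $[0,4,5]$, $[0,1,2]$, $[0,3,4]$, $[0,2,3]$, $[6,7,9]$, $[7,8,11]$, $[7,9,10]$, $[7,10,11]$, $[1,3,4]$, $[1,3,5]$, $[6,10,11]$, $[6,8,10]$, $[2,4,5]$, $[1,2,5]$, $[6,8,9]$, $[8,9,11]$. $KNO_{[(3^4,4^2)]}$ has faces: $[0,1,8,7]$, $[0,5,6,7]$, $[5,6,2,11]$, $[1,8,3,10]$, $[10,3,4,9]$, $[11,2,4,9]$, $[0,4,5]$, $[0,1,2]$, $[0,3,4]$, $[0,2,3]$, $[6,7,9]$, $[7,8,11]$, $[7,9,10]$, $[7,10,11]$, $[2,3,6]$, $[3,6,8]$, $[5,10,11]$, $[1,5,10]$, $[1,4,5]$, $[1,2,4]$, $[6,8,9]$, $[8,9,11]$. *)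

theory Defs
  imports "HOL-Analysis.Analysis"
begin

text \<open>
  An undirected cycle on \<open>n \<ge> 3\<close> distinct vertices is determined, up to the choice of starting point
  and direction, by its set of edges.  A polygonal face is therefore encoded as the set of edges of
  its boundary cycle (each edge being a two-element set), and a 2-complex as its set of faces.
  Edges and vertices of a complex are those of its faces.
\<close>

type_synonym 'a face = "'a set set"

definition dcyc :: "'a list \<Rightarrow> ('a \<times> 'a) set" where
  "dcyc xs = set (zip xs (rotate1 xs))"

definition cyc :: "'a list \<Rightarrow> 'a face" where
  "cyc xs = (\<lambda>(a, b). {a, b}) ` dcyc xs"

definition polygon :: "'a face \<Rightarrow> bool" where
  "polygon F \<longleftrightarrow> (\<exists>xs. distinct xs \<and> 3 \<le> length xs \<and> F = cyc xs)"

definition edges :: "'a face set \<Rightarrow> 'a set set" where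
  "edges X = \<Union>X"

definition vertices :: "'a face set \<Rightarrow> 'a set" where
  "vertices X = \<Union>(edges X)"

definition polyhedral_complex :: "'a face set \<Rightarrow> bool" where
  "polyhedral_complex X \<longleftrightarrow>
     finite X \<and> (\<forall>F\<in>X. polygon F) \<and>
     (\<forall>F\<in>X. \<forall>G\<in>X. F \<noteq> G \<longrightarrow>
        \<Union>F \<inter> \<Union>G = {} \<or> (\<exists>v. \<Union>F \<inter> \<Union>G = {v}) \<or> (\<exists>e \<in> F \<inter> G. \<Union>F \<inter> \<Union>G = e))"

text \<open>
  The geometric carrier, realised in the standard simplex on the vertices (functions from vertices
  to reals, with the product topology).  A face \<open>F\<close> is realised as the cone over its boundary cycle
  from its barycentre, i.e. as the union, over the edges \<open>{u, v}\<close> of \<open>F\<close>, of the triangles spanned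
  by \<open>u\<close>, \<open>v\<close> and the barycentre of \<open>F\<close>.  A point of such a triangle that is not on the edge has
  support exactly the vertex set of \<open>F\<close>, so two faces of a polyhedral complex meet in the
  realisation of their common vertex or edge only.
\<close>

definition vertex_point :: "'a \<Rightarrow> 'a \<Rightarrow> real" where
  "vertex_point v = indicator {v}"

definition barycentre :: "'a face \<Rightarrow> 'a \<Rightarrow> real" where
  "barycentre F = (\<lambda>w. indicator (\<Union>F) w / real (card (\<Union>F)))"

definition carrier_of :: "'a face set \<Rightarrow> ('a \<Rightarrow> real) set" where
  "carrier_of X =
     {\<lambda>w. a * vertex_point u w + b * vertex_point v w + c * barycentre F w | a b c u v F.
        F \<in> X \<and> {u, v} \<in> F \<and> 0 \<le> a \<and> 0 \<le> b \<and> 0 \<le> c \<and> a + b + c = 1}"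

text \<open>
  Compact connected 2-manifolds without boundary (second countability follows from compactness).
\<close>

definition surface :: "'b topology \<Rightarrow> bool" where
  "surface S \<longleftrightarrow>
     topspace S \<noteq> {} \<and> compact_space S \<and> connected_space S \<and> Hausdorff_space S \<and>
     (\<forall>p \<in> topspace S. \<exists>U. openin S U \<and> p \<in> U \<and>
        (\<exists>T :: (real^2) set. open T \<and> subtopology S U homeomorphic_space top_of_set T))"

definition surface_map :: "'a face set \<Rightarrow> bool" where
  "surface_map X \<longleftrightarrow> polyhedral_complex X \<and> surface (top_of_set (carrier_of X))"

definition euler_characteristic :: "'a face set \<Rightarrow> int" where
  "euler_characteristic X = int (card (vertices X)) - int (card (edges X)) + int (card X)"

text \<open>
  \<open>Fs\<close> lists the faces at \<open>v\<close> in their cyclic order: consecutive faces share the edge from \<open>v\<close> to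
  the corresponding entry of \<open>ws\<close>.  The starting face and the direction are arbitrary.
\<close>

definition faces_around :: "'a face set \<Rightarrow> 'a \<Rightarrow> 'a face list \<Rightarrow> bool" where
  "faces_around X v Fs \<longleftrightarrow>
     distinct Fs \<and> 3 \<le> length Fs \<and> set Fs = {F \<in> X. v \<in> \<Union>F} \<and>
     (\<exists>ws. length ws = length Fs \<and> distinct ws \<and>
        (\<forall>i < length Fs. {v, ws ! i} \<in> Fs ! i \<and> {v, ws ! (Suc i mod length ws)} \<in> Fs ! i))"

text \<open>
  The face sequence \<open>(a\<^sub>1\<^sup>n\<^sup>1, \<dots>)\<close> is given as the list of pairs \<open>(a\<^sub>1, n\<^sub>1), \<dots>\<close>;
  the cardinality of a face is its number of edges.
\<close>

definition has_face_sequence :: "'a face set \<Rightarrow> 'a \<Rightarrow> (nat \<times> nat) list \<Rightarrow> bool" where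
  "has_face_sequence X v ps \<longleftrightarrow>
     (\<exists>Fs. faces_around X v Fs \<and> map card Fs = concat (map (\<lambda>(a, n). replicate n a) ps))"

definition semi_equivelar_map :: "(nat \<times> nat) list \<Rightarrow> 'a face set \<Rightarrow> bool" where
  "semi_equivelar_map ps X \<longleftrightarrow> surface_map X \<and> (\<forall>v \<in> vertices X. has_face_sequence X v ps)"

text \<open>
  Orientability of the underlying surface, in terms of the map: the boundary cycles of the faces can
  be directed so that an edge common to two faces is traversed in opposite directions by them.
\<close>

definition orientable :: "'a face set \<Rightarrow> bool" where
  "orientable X \<longleftrightarrow>
     (\<exists>d. (\<forall>F\<in>X. \<exists>xs. distinct xs \<and> 3 \<le> length xs \<and> F = cyc xs \<and> d F = dcyc xs) \<and>
          (\<forall>F\<in>X. \<forall>G\<in>X. F \<noteq> G \<longrightarrow> d F \<inter> d G = {}))"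

definition isomorphic_maps :: "'a face set \<Rightarrow> 'b face set \<Rightarrow> bool" where
  "isomorphic_maps X Y \<longleftrightarrow>
     (\<exists>f. bij_betw f (vertices X) (vertices Y) \<and> (\<lambda>F. (\<lambda>e. f ` e) ` F) ` X = Y)"

definition KO1 :: "nat face set" where
  "KO1 = cyc ` {
     [0,1,8,7], [0,5,6,7], [5,6,11,2], [1,8,10,3], [3,10,9,4], [2,11,9,4],
     [0,4,5], [0,1,2], [0,3,4], [0,2,3], [6,7,9], [7,8,11], [7,9,10], [7,10,11],
     [2,3,5], [1,3,5], [6,10,11], [6,8,10], [1,4,5], [1,2,4], [6,8,9], [8,9,11]}"

definition KO2 :: "nat face set" where
  "KO2 = cyc ` {
     [0,1,8,7], [0,5,6,7], [5,6,11,3], [1,8,10,4], [4,10,9,2], [3,11,9,2],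
     [0,4,5], [0,1,2], [0,3,4], [0,2,3], [6,7,9], [7,8,11], [7,9,10], [7,10,11],
     [1,3,4], [1,3,5], [6,10,11], [6,8,10], [2,4,5], [1,2,5], [6,8,9], [8,9,11]}"

definition KNO :: "nat face set" where
  "KNO = cyc ` {
     [0,1,8,7], [0,5,6,7], [5,6,2,11], [1,8,3,10], [10,3,4,9], [11,2,4,9],
     [0,4,5], [0,1,2], [0,3,4], [0,2,3], [6,7,9], [7,8,11], [7,9,10], [7,10,11],
     [2,3,6], [3,6,8], [5,10,11], [1,5,10], [1,4,5], [1,2,4], [6,8,9], [8,9,11]}"

end

theory Submission
  imports Defs
begin

text \<open>
  At a vertex the two quadrilaterals share an edge, here called a rung.  The other end of a rung lies
  on the same two quadrilaterals, so the rungs form a perfect matching of the vertices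
  (\<open>quad_star_mate\<close>) and each quadrilateral has two opposite sides that are rungs
  (\<open>quad_star_next\<close>).  Hence the quadrilaterals form closed strips, a strip of \<open>n\<close> of them covering
  \<open>2 n\<close> vertices; \<open>n \<ge> 3\<close> because a rung differs from its two neighbours and these differ from each
  other.  The quadrilaterals at a vertex cover six vertices of its strip.  With twelve vertices in
  total there is therefore one strip of six quadrilaterals, or else each vertex belongs to one of two
  blocks of six vertices that are closed under adjacency in quadrilaterals.

  The second case is impossible (\<open>no_six_vertex_block\<close>).  The three inner vertices \<open>x, y, z\<close> of the
  fan of triangles at \<open>v\<close> lie in the block not containing \<open>v\<close>, which is the set of vertices of the
  quadrilaterals at \<open>y\<close>.  So \<open>yx\<close> and \<open>yz\<close> are the edges where the fan at \<open>y\<close> begins and ends, and \<open>v\<close> is the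
  third vertex of its first and of its last triangle, although these third vertices are distinct.

  A strip of six quadrilaterals closes up to an annulus or to a Moebius band, which fixes all the
  quadrilaterals up to naming the vertices (\<open>ex_strip_labelling\<close>).  The triangles at each vertex then
  form a fan between two known vertices through three of the six vertices that lie on no quadrilateral
  at it.  A search that fixes the fans one vertex after the other and keeps only fans that agree on
  common triangles is complete (\<open>search_complete\<close>).  It finds no solution for the Moebius band and ten
  for the annulus, and each of the ten is identified with one of the three maps by an explicit
  bijection (\<open>annulus_isomorphisms\<close>).

  Orientability of the first two maps is witnessed by coherent directions of their faces.  In the third
  map the direction of one face determines those of a chain of faces, each sharing an edge with the
  next, that comes back to the first face with the opposite direction.
\<close>

section \<open>Boundary cycles of polygons\<close>

lemma dcyc_conv_nth: "dcyc xs = (\<lambda>i. (xs ! i, xs ! (Suc i mod length xs))) ` {..<length xs}"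
  unfolding dcyc_def set_zip by (auto simp: nth_rotate1)

lemma cyc_conv_nth: "cyc xs = (\<lambda>i. {xs ! i, xs ! (Suc i mod length xs)}) ` {..<length xs}"
  unfolding cyc_def dcyc_conv_nth by (auto simp: image_image)

lemma cyc_triangle: "cyc [a, b, c] = {{a, b}, {b, c}, {c, a}}"
  by (auto simp: cyc_def dcyc_def)

lemma cyc_quad: "cyc [a, b, c, d] = {{a, b}, {b, c}, {c, d}, {d, a}}"
  by (auto simp: cyc_def dcyc_def)

lemma Union_cyc: "\<Union>(cyc xs) = set xs"
proof -
  have "\<Union>(cyc xs) = fst ` dcyc xs \<union> snd ` dcyc xs"
    by (force simp: cyc_def)
  also have "\<dots> = set xs"
    by (simp add: dcyc_def flip: set_map)
  finally show ?thesis .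
qed

text \<open>
  Two different positions with the same edge would each be the successor of the other, which is possible
  in cycles of length two only.
\<close>

lemma card_cyc:
  assumes "distinct xs" "3 \<le> length xs"
  shows "card (cyc xs) = length xs"
proof -
  have "inj_on (\<lambda>i. {xs ! i, xs ! (Suc i mod length xs)}) {..<length xs}"
  proof (rule inj_onI)
    fix i j assume ij: "i \<in> {..<length xs}" "j \<in> {..<length xs}"
      and eq: "{xs ! i, xs ! (Suc i mod length xs)} = {xs ! j, xs ! (Suc j mod length xs)}"
    have lt: "Suc i mod length xs < length xs" "Suc j mod length xs < length xs"
      using assms(2) by (auto intro: mod_less_divisor)
    have "i = j \<or> i = Suc j mod length xs \<and> j = Suc i mod length xs"
      using eq ij lt assms(1) by (auto simp: doubleton_eq_iff nth_eq_iff_index_eq)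
    then show "i = j"
      using ij assms(2) by (auto simp: mod_Suc split: if_splits)
  qed
  then show ?thesis by (simp add: cyc_conv_nth card_image)
qed

lemma cyc_map: "cyc (map f xs) = (\<lambda>e. f ` e) ` cyc xs"
  by (auto simp: cyc_def dcyc_def zip_map_map image_image rotate1_map case_prod_unfold)

lemma dcyc_append_commute: "dcyc (xs @ ys) = dcyc (ys @ xs)"
proof -
  have "dcyc (x # zs) = dcyc (zs @ [x])" for x and zs :: "'a list"
  proof (cases zs)
    case (Cons a as)
    then show ?thesis
      using zip_append[of "a # as" "as @ [x]" "[x]" "[a]"] by (auto simp: dcyc_def)
  qed simp
  then show ?thesis
    by (induction xs arbitrary: ys) (simp, metis append.assoc append_Cons append_Nil)
qed

lemma dcyc_rev: "dcyc (rev xs) = (dcyc xs)\<inverse>"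
proof (cases xs)
  case (Cons x zs)
  have "dcyc (rev xs) = dcyc (x # rev zs)"
    using dcyc_append_commute[of "rev zs" "[x]"] Cons by simp
  also have "\<dots> = set (zip (x # rev zs) (rev (x # zs)))" by (simp add: dcyc_def)
  also have "\<dots> = set (zip (rev (zs @ [x])) (rev (x # zs)))" by simp
  also have "\<dots> = set (zip (zs @ [x]) (x # zs))" by (subst zip_rev) auto
  also have "\<dots> = (dcyc xs)\<inverse>"
    using Cons by (auto simp: dcyc_def set_zip)
  finally show ?thesis .
qed (simp add: dcyc_def)

lemma cyc_append_commute: "cyc (xs @ ys) = cyc (ys @ xs)"
  by (simp add: cyc_def dcyc_append_commute[of xs])

lemma cyc_rev: "cyc (rev xs) = cyc xs"
  by (force simp: cyc_def dcyc_rev insert_commute)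

lemma polygon_vertices_of_card_3:
  assumes "polygon F" "card F = 3"
  obtains a b c where "distinct [a, b, c]" "F = cyc [a, b, c]"
proof -
  obtain xs where xs: "distinct xs" "3 \<le> length xs" "F = cyc xs"
    using assms(1) by (auto simp: polygon_def)
  then have "length xs = 3" using card_cyc assms(2) by metis
  then show ?thesis using xs that by (auto simp: numeral_3_eq_3 length_Suc_conv)
qed

lemma polygon_vertices_of_card_4:
  assumes "polygon F" "card F = 4"
  obtains a b c d where "distinct [a, b, c, d]" "F = cyc [a, b, c, d]"
proof -
  obtain xs where xs: "distinct xs" "3 \<le> length xs" "F = cyc xs"
    using assms(1) by (auto simp: polygon_def)
  then have "length xs = Suc (Suc (Suc (Suc 0)))" using card_cyc[of xs] assms(2) by simp
  then show ?thesis using xs that by (auto simp: length_Suc_conv)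
qed

text \<open>
  A face of the complex is known through its edges at a vertex \<open>v\<close>.  These determine a triangle, and a
  quadrilateral up to the vertex opposite \<open>v\<close>.
\<close>

lemma triangle_at_corner:
  assumes "polygon F" "card F = 3" "{v, a} \<in> F" "{v, b} \<in> F" "a \<noteq> b"
  shows "distinct [v, a, b]" "F = cyc [v, a, b]"
proof -
  obtain p q r where *: "distinct [p, q, r]" "F = cyc [p, q, r]"
    by (rule polygon_vertices_of_card_3[OF assms(1,2)])
  show "distinct [v, a, b]"
    using * assms(3-5) by (auto simp: cyc_triangle doubleton_eq_iff)
  show "F = cyc [v, a, b]"
    using * assms(3-5) by (auto simp: cyc_triangle doubleton_eq_iff)
qed

lemma quad_at_corner:
  assumes "polygon F" "card F = 4" "{v, a} \<in> F" "{v, b} \<in> F" "a \<noteq> b"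
  obtains p where "distinct [v, a, p, b]" "F = cyc [v, a, p, b]"
proof -
  obtain x y z w where *: "distinct [x, y, z, w]" "F = cyc [x, y, z, w]"
    by (rule polygon_vertices_of_card_4[OF assms(1,2)])
  \<comment> \<open>Rotate the cycle so that it starts at the given corner.\<close>
  have "F = cyc [y, z, w, x]" "F = cyc [z, w, x, y]" "F = cyc [w, x, y, z]"
    using *(2) by (auto simp: cyc_quad)
  moreover have "v = x \<or> v = y \<or> v = z \<or> v = w"
    using * assms(3) by (auto simp: cyc_quad doubleton_eq_iff)
  ultimately obtain b' p d' where v: "distinct [v, b', p, d']" "F = cyc [v, b', p, d']"
    using *(1,2) by fastforce
  then have "a = b' \<and> b = d' \<or> a = d' \<and> b = b'"
    using assms(3-5) by (auto simp: cyc_quad doubleton_eq_iff)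
  moreover have "cyc [v, d', p, b'] = cyc [v, b', p, d']"
    by (auto simp: cyc_quad insert_commute)
  ultimately show ?thesis using v that[of p] by auto
qed

text \<open>
  Cycles given as lists are compared by evaluation.  The canonical form is the rotation or reflection
  that starts at the smallest entry and continues with the smaller one of its two neighbours.
\<close>

definition canonical_cycle :: "'a::linorder list \<Rightarrow> 'a list" where
  "canonical_cycle xs =
     (let m = foldr min xs (hd xs)
      in case dropWhile (\<lambda>x. x \<noteq> m) xs @ takeWhile (\<lambda>x. x \<noteq> m) xs of
           [] \<Rightarrow> [] | y # ys \<Rightarrow> y # (if hd ys \<le> last ys then ys else rev ys))"

lemma cyc_canonical_cycle: "cyc (canonical_cycle xs) = cyc xs"
proof -
  define m where "m = foldr min xs (hd xs)"
  define ys where "ys = dropWhile (\<lambda>x. x \<noteq> m) xs @ takeWhile (\<lambda>x. x \<noteq> m) xs"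
  have "cyc ys = cyc xs"
    using cyc_append_commute[of "dropWhile (\<lambda>x. x \<noteq> m) xs" "takeWhile (\<lambda>x. x \<noteq> m) xs"] by (simp add: ys_def)
  moreover have "cyc (z # rev zs) = cyc (z # zs)" for z and zs :: "'a list"
    using cyc_append_commute[of "[z]" "rev zs"] cyc_rev[of "z # zs"] by simp
  moreover have "canonical_cycle xs = (case ys of [] \<Rightarrow> [] | z # zs \<Rightarrow> z # (if hd zs \<le> last zs then zs else rev zs))"
    by (simp add: canonical_cycle_def Let_def ys_def m_def)
  ultimately show ?thesis by (auto split: list.splits)
qed

lemma cyc_mem_of_canonical_cycle:
  assumes "canonical_cycle xs \<in> canonical_cycle ` set fs"
  shows "cyc (map f xs) \<in> cyc ` map f ` set fs"
proof -
  obtain ys where "ys \<in> set fs" "canonical_cycle xs = canonical_cycle ys" using assms by blast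
  then show ?thesis
    by (metis (no_types, lifting) cyc_canonical_cycle cyc_map image_eqI)
qed

definition same_faces :: "'a::linorder list list \<Rightarrow> 'a list list \<Rightarrow> bool" where
  "same_faces fs gs \<longleftrightarrow> canonical_cycle ` set fs = canonical_cycle ` set gs"

text \<open>
  The comparison is made on labels; an arbitrary vertex naming \<open>f\<close> can be applied afterwards because the
  cycle of a mapped list is the image of the cycle.
\<close>

lemma same_faces_cyc:
  assumes "same_faces fs gs"
  shows "cyc ` map f ` set fs = cyc ` map f ` set gs"
proof -
  have "cyc ` map f ` set hs = (\<lambda>F. (\<lambda>e. f ` e) ` F) ` cyc ` canonical_cycle ` set hs" for hs
    by (simp add: image_image cyc_map cyc_canonical_cycle)
  with assms show ?thesis by (simp add: same_faces_def)
qed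

section \<open>Triangles and quadrilaterals around a vertex\<close>

locale quads_and_triangles =
  fixes K :: "'a face set"
  assumes complex: "polyhedral_complex K"
    and face_sequence: "\<And>v. v \<in> vertices K \<Longrightarrow> has_face_sequence K v [(3, 4), (4, 2)]"
begin

definition faces_at :: "nat \<Rightarrow> 'a \<Rightarrow> 'a face set" where
  "faces_at n v = {F \<in> K. card F = n \<and> v \<in> \<Union>F}"

text \<open>
  The two quadrilaterals at \<open>v\<close> share the edge \<open>vw\<close>, the rung of \<open>v\<close>.  Going along the strip of
  quadrilaterals in its two directions, the neighbours of \<open>v\<close> are \<open>r\<close> and \<open>l\<close>, those of \<open>w\<close> are \<open>p\<close> and \<open>q\<close>.
\<close>

definition quad_star :: "'a \<Rightarrow> 'a \<Rightarrow> 'a \<Rightarrow> 'a \<Rightarrow> 'a \<Rightarrow> 'a \<Rightarrow> bool" where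
  "quad_star v w r p l q \<longleftrightarrow> distinct [v, w, r, p, l, q] \<and>
     faces_at 4 v = {cyc [v, r, p, w], cyc [v, l, q, w]}"

text \<open>
  The triangles at \<open>v\<close> in cyclic order; \<open>l\<close> and \<open>r\<close> are the vertices at which they meet the
  quadrilaterals.
\<close>

definition triangle_fan :: "'a \<Rightarrow> 'a \<Rightarrow> 'a \<Rightarrow> 'a \<Rightarrow> 'a \<Rightarrow> 'a \<Rightarrow> bool" where
  "triangle_fan v l x y z r \<longleftrightarrow> distinct [v, l, x, y, z, r] \<and>
     faces_at 3 v = {cyc [v, l, x], cyc [v, x, y], cyc [v, y, z], cyc [v, z, r]}"

lemma mem_faces_at: "cyc xs \<in> faces_at n v \<longleftrightarrow> cyc xs \<in> K \<and> card (cyc xs) = n \<and> v \<in> set xs"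
  by (simp only: faces_at_def mem_Collect_eq Union_cyc)

lemma faces_at_other:
  assumes "cyc xs \<in> faces_at n v" "u \<in> set xs"
  shows "cyc xs \<in> faces_at n u"
  using assms by (simp only: mem_faces_at)

lemma polygon_face: "F \<in> K \<Longrightarrow> polygon F"
  using complex by (simp add: polyhedral_complex_def)

lemma vertices_iff: "v \<in> vertices K \<longleftrightarrow> (\<exists>F\<in>K. v \<in> \<Union>F)"
  by (auto simp: vertices_def edges_def)

lemma common_edge:
  assumes "F \<in> K" "G \<in> K" "F \<noteq> G" "u \<in> \<Union>F" "u \<in> \<Union>G" "v \<in> \<Union>F" "v \<in> \<Union>G" "u \<noteq> v"
  shows "{u, v} \<in> F"
proof -
  have "\<exists>e \<in> F \<inter> G. \<Union>F \<inter> \<Union>G = e"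
    using complex assms unfolding polyhedral_complex_def by (metis IntI empty_iff singletonD)
  then obtain e where e: "e \<in> F" "\<Union>F \<inter> \<Union>G = e" by blast
  then obtain a b where "e = {a, b}"
    using polygon_face[OF assms(1)] by (auto simp: polygon_def cyc_def)
  moreover have "{u, v} \<subseteq> e" using e(2) assms(4-7) by blast
  ultimately have "e = {u, v}" using assms(8) by auto
  with e(1) show ?thesis by simp
qed

text \<open>
  The face sequence gives six distinct neighbours of \<open>v\<close>.  The vertices \<open>p\<close> and \<open>q\<close> opposite \<open>v\<close> in the
  quadrilaterals differ from them and from each other: two faces with two common vertices share the
  edge between these, but a diagonal of a quadrilateral is not one of its edges.
\<close>

lemma vertex_star:
  assumes "v \<in> vertices K"
  obtains w r p l q x y z where "quad_star v w r p l q" "triangle_fan v l x y z r"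
    "{x, y, z} \<inter> {w, r, p, l, q} = {}"
    "\<And>F. F \<in> K \<Longrightarrow> v \<in> \<Union>F \<Longrightarrow> card F = 3 \<or> card F = 4"
proof -
  have "\<exists>Fs. faces_around K v Fs \<and> map card Fs = [3, 3, 3, 3, 4, 4]"
    using face_sequence[OF assms] by (simp add: has_face_sequence_def numeral_eq_Suc)
  then obtain Fs where Fs: "faces_around K v Fs" "map card Fs = [3, 3, 3, 3, 4, 4]"
    by (elim exE conjE)
  obtain F0 F1 F2 F3 F4 F5 where F: "Fs = [F0, F1, F2, F3, F4, F5]"
    using Fs(2) by (auto simp: map_eq_Cons_conv)
  with Fs(2) have card: "card F0 = 3" "card F1 = 3" "card F2 = 3" "card F3 = 3" "card F4 = 4" "card F5 = 4"
    by auto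
  obtain ws where ws: "length ws = 6" "distinct ws"
      "\<forall>i < 6. {v, ws ! i} \<in> Fs ! i \<and> {v, ws ! (Suc i mod 6)} \<in> Fs ! i"
  proof -
    have "length Fs = 6" by (simp add: F)
    then show ?thesis using Fs(1) that unfolding faces_around_def by metis
  qed
  obtain l x y z r w where W: "ws = [l, x, y, z, r, w]"
    using ws(1) by (auto simp: numeral_eq_Suc length_Suc_conv)
  have spoke: "{v, ws ! i} \<in> Fs ! i" "{v, ws ! (Suc i mod 6)} \<in> Fs ! i" if "i < 6" for i
    using ws(3) that by blast+
  have spokes: "{v, l} \<in> F0" "{v, x} \<in> F0" "{v, x} \<in> F1" "{v, y} \<in> F1" "{v, y} \<in> F2" "{v, z} \<in> F2"
    "{v, z} \<in> F3" "{v, r} \<in> F3" "{v, r} \<in> F4" "{v, w} \<in> F4" "{v, w} \<in> F5" "{v, l} \<in> F5"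
    using spoke[of 0] spoke[of 1] spoke[of 2] spoke[of 3] spoke[of 4] spoke[of 5] by (simp_all add: W F)
  have dist: "distinct [l, x, y, z, r, w]" using ws(2) W by simp
  have at_v: "{F \<in> K. v \<in> \<Union>F} = {F0, F1, F2, F3, F4, F5}"
    using Fs(1) by (simp add: faces_around_def F)
  then have in_K: "F0 \<in> K" "F1 \<in> K" "F2 \<in> K" "F3 \<in> K" "F4 \<in> K" "F5 \<in> K" by auto
  note poly = in_K[THEN polygon_face]
  have "l \<noteq> x" "x \<noteq> y" "y \<noteq> z" "z \<noteq> r" using dist by auto
  note T0 = triangle_at_corner[OF poly(1) card(1) spokes(1,2) this(1)]
    and T1 = triangle_at_corner[OF poly(2) card(2) spokes(3,4) this(2)]
    and T2 = triangle_at_corner[OF poly(3) card(3) spokes(5,6) this(3)]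
    and T3 = triangle_at_corner[OF poly(4) card(4) spokes(7,8) this(4)]
  obtain p where p: "distinct [v, r, p, w]" "F4 = cyc [v, r, p, w]"
    by (rule quad_at_corner[OF poly(5) card(5) spokes(9,10)]) (use dist in auto)
  obtain q where q: "distinct [v, l, q, w]" "F5 = cyc [v, l, q, w]"
    by (rule quad_at_corner[OF poly(6) card(6) spokes(12,11)]) (use dist in auto)
  have diag: "{v, p} \<notin> F4" "{v, q} \<notin> F5"
    using p q by (auto simp: cyc_quad doubleton_eq_iff)
  have "{v, r} \<notin> F5"
    unfolding q(2) cyc_quad using q(1) p(1) dist by (auto simp: doubleton_eq_iff)
  then have F45: "F4 \<noteq> F5" using spokes(9) by blast
  have "u \<noteq> p" "u \<noteq> q" if "u \<in> {l, x, y, z, r}" for u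
  proof -
    have "u \<in> \<Union>F0 \<or> u \<in> \<Union>F2 \<or> u \<in> \<Union>F3"
      using that T0(2) T2(2) T3(2) by (auto simp: Union_cyc)
    moreover have "v \<in> \<Union>F0" "v \<in> \<Union>F2" "v \<in> \<Union>F3"
      using T0(2) T2(2) T3(2) by (simp_all add: Union_cyc)
    ultimately obtain T where "T \<in> K" "card T = 3" "v \<in> \<Union>T" "u \<in> \<Union>T"
      using in_K card by metis
    moreover have "p \<in> \<Union>F4" "q \<in> \<Union>F5" "v \<in> \<Union>F4" "v \<in> \<Union>F5"
      by (auto simp: p(2) q(2) Union_cyc)
    ultimately show "u \<noteq> p" "u \<noteq> q"
      using common_edge[of F4 T v p] common_edge[of F5 T v q] in_K(5,6) card(5,6) p(1) q(1) diag by fastforce+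
  qed
  moreover have "p \<noteq> q"
    using common_edge[of F4 F5 v p] in_K F45 diag(1) p q by (auto simp: Union_cyc)
  ultimately have nine: "distinct [v, w, r, p, l, q, x, y, z]"
    using dist p(1) q(1) T0(1) T2(1) by auto
  have "faces_at 4 v = {F4, F5}"
  proof -
    have "faces_at 4 v = {F \<in> {F0, F1, F2, F3, F4, F5}. card F = 4}"
      unfolding at_v[symmetric] faces_at_def by blast
    also have "\<dots> = {F4, F5}" using card by auto
    finally show ?thesis .
  qed
  then have 1: "quad_star v w r p l q"
    using nine p(2) q(2) unfolding quad_star_def by simp
  have "faces_at 3 v = {F0, F1, F2, F3}"
  proof -
    have "faces_at 3 v = {F \<in> {F0, F1, F2, F3, F4, F5}. card F = 3}"
      unfolding at_v[symmetric] faces_at_def by blast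
    also have "\<dots> = {F0, F1, F2, F3}" using card by auto
    finally show ?thesis .
  qed
  moreover have "distinct [v, l, x, y, z, r]" using nine by auto
  ultimately have 2: "triangle_fan v l x y z r"
    using T0(2) T1(2) T2(2) T3(2) unfolding triangle_fan_def by simp
  have 3: "card F = 3 \<or> card F = 4" if "F \<in> K" "v \<in> \<Union>F" for F
  proof -
    have "F \<in> {F0, F1, F2, F3, F4, F5}" unfolding at_v[symmetric] using that by blast
    then show ?thesis using card by auto
  qed
  show ?thesis
    by (rule that[OF 1 2 _ 3]) (use nine in auto)
qed

lemma triangle_fan_reverse: "triangle_fan v l x y z r \<longleftrightarrow> triangle_fan v r z y x l"
proof -
  have "cyc [v, a, b] = cyc [v, b, a]" for a b :: 'a
    by (auto simp: cyc_triangle insert_commute)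
  then show ?thesis unfolding triangle_fan_def by (auto simp: insert_commute)
qed

lemma quad_star_swap: "quad_star v w r p l q \<longleftrightarrow> quad_star v w l q r p"
  unfolding quad_star_def by (auto simp: insert_commute)

lemma cyc_quad_reverse: "cyc [v, r, p, w] = cyc [w, p, r, v]"
  by (auto simp: cyc_quad insert_commute)

lemma cyc_quad_determined:
  assumes "distinct [v, r, p, w]" "distinct [v, r', p', w']" "cyc [v, r, p, w] = cyc [v, r', p', w']"
  shows "p' = p \<and> (r' = r \<and> w' = w \<or> r' = w \<and> w' = r)"
proof -
  have "{u. {v, u} \<in> cyc [v, r, p, w]} = {r, w}" "{u. {v, u} \<in> cyc [v, r', p', w']} = {r', w'}"
    using assms(1,2) by (auto simp: cyc_quad doubleton_eq_iff)
  then have "{r, w} = {r', w'}" using assms(3) by simp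
  moreover have "{v, r, p, w} = {v, r', p', w'}"
    using arg_cong[OF assms(3), of Union] by (simp only: Union_cyc list.set)
  ultimately show ?thesis using assms(1,2) by (auto simp: doubleton_eq_iff)
qed

text \<open>
  The neighbour \<open>w\<close> of \<open>v\<close> is the only one that belongs to both quadrilaterals; the remaining names are
  fixed up to exchanging these two faces.
\<close>

lemma quad_star_unique:
  assumes "quad_star v w r p l q" "quad_star v w' r' p' l' q'"
  shows "w' = w \<and> (r' = r \<and> p' = p \<and> l' = l \<and> q' = q \<or> r' = l \<and> p' = q \<and> l' = r \<and> q' = p)"
proof -
  have eq: "{cyc [v, r, p, w], cyc [v, l, q, w]} = {cyc [v, r', p', w'], cyc [v, l', q', w']}"
    and d: "distinct [v, w, r, p, l, q]" "distinct [v, w', r', p', l', q']"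
    using assms by (auto simp: quad_star_def)
  have d': "distinct [v, r, p, w]" "distinct [v, l, q, w]" "distinct [v, r', p', w']" "distinct [v, l', q', w']"
    using d by auto
  note det = cyc_quad_determined
  from eq consider "cyc [v, r, p, w] = cyc [v, r', p', w']" "cyc [v, l, q, w] = cyc [v, l', q', w']"
    | "cyc [v, r, p, w] = cyc [v, l', q', w']" "cyc [v, l, q, w] = cyc [v, r', p', w']"
    by (auto simp: doubleton_eq_iff)
  then show ?thesis
  proof cases
    case 1
    show ?thesis using det[OF d'(1,3) 1(1)] det[OF d'(2,4) 1(2)] d by auto
  next
    case 2
    show ?thesis using det[OF d'(1,4) 2(1)] det[OF d'(2,3) 2(2)] d by auto
  qed
qed

lemma ex_quad_star:
  assumes "v \<in> vertices K"
  shows "\<exists>w r p l q. quad_star v w r p l q"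
  by (rule vertex_star[OF assms]) blast

lemma set_subset_vertices:
  assumes "cyc xs \<in> K"
  shows "set xs \<subseteq> vertices K"
  unfolding Union_cyc[symmetric] subset_iff vertices_iff using assms by blast

lemma quad_star_subset_vertices:
  assumes "quad_star v w r p l q"
  shows "{v, w, r, p, l, q} \<subseteq> vertices K"
proof -
  have "cyc [v, r, p, w] \<in> K" "cyc [v, l, q, w] \<in> K"
    using assms mem_faces_at unfolding quad_star_def by blast+
  from this[THEN set_subset_vertices] show ?thesis by simp
qed

text \<open>
  There are only two quadrilaterals at \<open>w\<close>, and the two at \<open>v\<close> both contain \<open>w\<close>.  So being joined by a
  rung is a symmetric relation.
\<close>

lemma quad_star_mate:
  assumes "quad_star v w r p l q"
  shows "quad_star w v p r q l"
proof -
  have d: "distinct [v, w, r, p, l, q]" and eq: "faces_at 4 v = {cyc [v, r, p, w], cyc [v, l, q, w]}"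
    using assms by (auto simp: quad_star_def)
  obtain w' r' p' l' q' where w': "quad_star w w' r' p' l' q'"
    using ex_quad_star[of w] quad_star_subset_vertices[OF assms] by blast
  let ?A = "cyc [w, p, r, v]" and ?B = "cyc [w, q, l, v]"
  have A: "?A = cyc [v, r, p, w]" and B: "?B = cyc [v, l, q, w]"
    by (rule cyc_quad_reverse)+
  have AB: "?A \<in> faces_at 4 w" "?B \<in> faces_at 4 w"
    using faces_at_other[of "[w, p, r, v]" 4 v w] faces_at_other[of "[w, q, l, v]" 4 v w]
    by (simp_all add: A B eq)
  have "p \<noteq> q" "distinct [w, p, r, v]" "distinct [w, q, l, v]" using d by auto
  then have "?A \<noteq> ?B"
    using cyc_quad_determined[of w p r v q l v] d by auto
  then have "faces_at 4 w = {?A, ?B}"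
    using AB w' unfolding quad_star_def by (metis doubleton_eq_iff insert_iff singletonD)
  then show ?thesis
    using d unfolding quad_star_def by auto
qed

text \<open>
  The strip continues beyond the quadrilateral \<open>v r p w\<close> across the edge \<open>rp\<close>.  The rung of \<open>r\<close> is a
  side of this quadrilateral, hence \<open>rp\<close> or \<open>rv\<close>.  If it were \<open>rv\<close>, then both quadrilaterals at \<open>r\<close> would
  be quadrilaterals at \<open>v\<close>, but only one of those contains \<open>r\<close>.
\<close>

lemma quad_star_next:
  assumes "quad_star v w r p l q"
  obtains r' p' where "quad_star r p r' p' v w"
proof -
  have d: "distinct [v, w, r, p, l, q]" and eq: "faces_at 4 v = {cyc [v, r, p, w], cyc [v, l, q, w]}"
    using assms by (auto simp: quad_star_def)
  obtain m s t s' t' where r: "quad_star r m s t s' t'"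
    using ex_quad_star[of r] quad_star_subset_vertices[OF assms] by blast
  let ?A = "cyc [r, v, w, p]"
  have A: "?A = cyc [v, r, p, w]" by (auto simp: cyc_quad insert_commute)
  have *: "\<exists>r' p'. quad_star r p r' p' v w" if r: "quad_star r m s t s' t'" and A': "?A = cyc [r, s', t', m]" for m s t s' t'
  proof -
    have dr: "distinct [r, m, s, t, s', t']" and eqr: "faces_at 4 r = {cyc [r, s, t, m], cyc [r, s', t', m]}"
      using r by (auto simp: quad_star_def)
    have "t' = w \<and> (s' = v \<and> m = p \<or> s' = p \<and> m = v)"
      using cyc_quad_determined[OF _ _ A'] d dr by auto
    moreover have "m \<noteq> v"
    proof
      assume "m = v"
      then have "cyc [r, s, t, v] \<in> faces_at 4 r" by (simp add: eqr)
      then have "cyc [r, s, t, v] \<in> faces_at 4 v"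
        by (rule faces_at_other) simp
      then have "cyc [r, s, t, v] = ?A \<or> cyc [r, s, t, v] = cyc [v, l, q, w]"
        by (simp add: eq A)
      moreover have "cyc [r, s, t, v] \<noteq> ?A"
        using cyc_quad_determined[of r s t m s' t' m] dr A' \<open>m = v\<close> by auto
      moreover have "cyc [r, s, t, v] \<noteq> cyc [v, l, q, w]"
        using Union_cyc[of "[r, s, t, v]"] Union_cyc[of "[v, l, q, w]"] d by auto
      ultimately show False by blast
    qed
    ultimately show ?thesis using r by auto
  qed
  have "?A \<in> faces_at 4 v" by (simp add: A eq)
  then have "?A \<in> faces_at 4 r" by (rule faces_at_other) simp
  then have "?A = cyc [r, s, t, m] \<or> ?A = cyc [r, s', t', m]"
    using r unfolding quad_star_def by auto
  then show ?thesis
    using *[OF r] *[of m s' t' s t] r quad_star_swap[of r m s t s' t'] that by blast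
qed

lemma fan_subset_vertices:
  assumes "triangle_fan v l x y z r"
  shows "{v, l, x, y, z, r} \<subseteq> vertices K"
proof -
  have "cyc [v, l, x] \<in> K" "cyc [v, y, z] \<in> K" "cyc [v, z, r] \<in> K"
    using assms mem_faces_at unfolding triangle_fan_def by blast+
  from this[THEN set_subset_vertices] show ?thesis by simp
qed

text \<open>
  The vertex \<open>v\<close> can stand at any position of the list \<open>[a, b, c]\<close>.  Cancelling it from equal vertex
  sets of triangles leaves their sides opposite \<open>v\<close>.
\<close>

lemma fan_triangle_cases:
  assumes "triangle_fan v l x y z r" "cyc [a, b, c] \<in> faces_at 3 v" "distinct [a, b, c]" "{a, b, c} = {v, s, t}"
  shows "{s, t} = {l, x} \<or> {s, t} = {x, y} \<or> {s, t} = {y, z} \<or> {s, t} = {z, r}"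
proof -
  have "card {v, s, t} = 3" unfolding assms(4)[symmetric] using assms(3) by simp
  then have v: "v \<notin> {s, t}" by (auto simp: card_insert_if split: if_splits)
  have cancel: "{s, t} = {d, e}" if "{v, s, t} = {v, d, e}" "v \<notin> {d, e}" for d e
    using insert_ident[OF v that(2)] that(1) by simp
  have "v \<notin> {l, x}" "v \<notin> {x, y}" "v \<notin> {y, z}" "v \<notin> {z, r}"
    using assms(1) by (simp_all add: triangle_fan_def)
  note c = cancel[OF _ this(1)] cancel[OF _ this(2)] cancel[OF _ this(3)] cancel[OF _ this(4)]
  have "{v, s, t} = {v, l, x} \<or> {v, s, t} = {v, x, y} \<or> {v, s, t} = {v, y, z} \<or> {v, s, t} = {v, z, r}"
  proof -
    have "cyc [a, b, c] = cyc [v, l, x] \<or> cyc [a, b, c] = cyc [v, x, y] \<or>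
        cyc [a, b, c] = cyc [v, y, z] \<or> cyc [a, b, c] = cyc [v, z, r]"
      using assms(1,2) by (simp add: triangle_fan_def)
    moreover have "{v, s, t} = {v, d, e}" if "cyc [a, b, c] = cyc [v, d, e]" for d e
      using arg_cong[OF that, of Union] assms(4) by (simp only: Union_cyc list.set)
    ultimately show ?thesis by meson
  qed
  then show ?thesis using c by meson
qed

text \<open>
  The quadrilaterals at \<open>v\<close> exhaust \<open>S\<close>, so the inner fan vertices \<open>x, y, z\<close> lie in \<open>S'\<close>, and \<open>S'\<close> is
  exhausted by the quadrilaterals at \<open>y\<close>.  A vertex of a triangle at \<open>y\<close> that also lies on a
  quadrilateral at \<open>y\<close> is an end of the fan of \<open>y\<close>.  Thus \<open>x\<close> and \<open>z\<close> are the two ends of that fan, and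
  both its outer triangles have \<open>v\<close> as third vertex.
\<close>

lemma no_six_vertex_block:
  assumes V: "vertices K = S \<union> S'" "S \<inter> S' = {}" "card S = 6" "card S' = 6"
    and S: "\<And>v w r p l q. quad_star v w r p l q \<Longrightarrow> v \<in> S \<Longrightarrow> {v, w, r, p, l, q} \<subseteq> S"
    and S': "\<And>v w r p l q. quad_star v w r p l q \<Longrightarrow> v \<in> S' \<Longrightarrow> {v, w, r, p, l, q} \<subseteq> S'"
    and v: "v \<in> S"
  shows False
proof -
  have fin: "finite S" "finite S'" using V(3,4) by (auto intro: card_ge_0_finite)
  have card_star: "card {v, w, r, p, l, q} = 6" if "quad_star v w r p l q" for v w r p l q
    using that unfolding quad_star_def by simp
  have vK: "v \<in> vertices K" using v V(1) by simp
  obtain w r p l q x y z where star: "quad_star v w r p l q" and fan: "triangle_fan v l x y z r"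
    and xyz: "{x, y, z} \<inter> {w, r, p, l, q} = {}"
    by (rule vertex_star[OF vK]) (rule that)
  have d: "distinct [v, l, x, y, z, r]" and T: "cyc [v, x, y] \<in> faces_at 3 v" "cyc [v, y, z] \<in> faces_at 3 v"
    using fan by (simp_all add: triangle_fan_def)
  have "S = {v, w, r, p, l, q}"
    using card_subset_eq[OF fin(1) S[OF star v]] card_star[OF star] V(3) by simp
  with xyz d have "x \<notin> S" "y \<notin> S" "z \<notin> S" by auto
  then have xyz': "x \<in> S'" "y \<in> S'" "z \<in> S'"
    using fan_subset_vertices[OF fan] V(1) by auto
  have yK: "y \<in> vertices K" using xyz' V(1) by simp
  obtain w' r' p' l' q' x' y' z' where star': "quad_star y w' r' p' l' q'" and fan': "triangle_fan y l' x' y' z' r'"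
    and "{x', y', z'} \<inter> {w', r', p', l', q'} = {}"
    by (rule vertex_star[OF yK]) (rule that)
  moreover have "S' = {y, w', r', p', l', q'}"
    using card_subset_eq[OF fin(2) S'[OF star' xyz'(2)]] card_star[OF star'] V(4) by simp
  moreover have d': "distinct [y, l', x', y', z', r']"
    using fan' by (simp add: triangle_fan_def)
  ultimately have S'_fan: "S' \<inter> {l', x', y', z', r'} \<subseteq> {l', r'}" by auto
  have vxy: "distinct [v, x, y]" "distinct [v, y, z]" using d by auto
  have "{x, v} = {l', x'} \<or> {x, v} = {x', y'} \<or> {x, v} = {y', z'} \<or> {x, v} = {z', r'}"
    by (rule fan_triangle_cases[OF fan' faces_at_other[OF T(1)] vxy(1)]) auto
  moreover have "{z, v} = {l', x'} \<or> {z, v} = {x', y'} \<or> {z, v} = {y', z'} \<or> {z, v} = {z', r'}"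
    by (rule fan_triangle_cases[OF fan' faces_at_other[OF T(2)] vxy(2)]) auto
  moreover have "v \<noteq> l'" "v \<noteq> r'"
    using star' S' xyz'(2) v V(2) by blast+
  moreover have "x \<notin> {x', y', z'}" "z \<notin> {x', y', z'}"
    using xyz' S'_fan d' by auto
  moreover have "x \<noteq> z" "x' \<noteq> z'" using d d' by auto
  ultimately show False by (auto simp: doubleton_eq_iff)
qed

end

section \<open>Strips of quadrilaterals\<close>

text \<open>
  A walk along a strip of quadrilaterals: consecutive rungs \<open>a n, b n\<close> are opposite sides of a
  quadrilateral, with the \<open>a\<close> on one side of the strip and the \<open>b\<close> on the other.  The walk never ends and
  goes round the strip again and again, possibly with the two sides exchanged.
\<close>

locale quad_ladder = quads_and_triangles K for K :: "'a face set" +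
  fixes a b :: "nat \<Rightarrow> 'a"
  assumes ladder_star:
    "\<And>n. quad_star (a (Suc n)) (b (Suc n)) (a (Suc (Suc n))) (b (Suc (Suc n))) (a n) (b n)"

lemma (in quads_and_triangles) ex_ladder:
  assumes "v \<in> vertices K"
  obtains a b where "quad_ladder K a b"
proof -
  \<comment> \<open>The state of the walk consists of the last two rungs; the walk can be continued beyond them.\<close>
  define P where "P n s \<longleftrightarrow> (\<exists>r p. quad_star (fst (snd s)) (snd (snd s)) r p (fst (fst s)) (snd (fst s)))"
    for n :: nat and s :: "('a \<times> 'a) \<times> ('a \<times> 'a)"
  define Q where "Q n s t \<longleftrightarrow> fst t = snd s \<and>
      quad_star (fst (snd s)) (snd (snd s)) (fst (snd t)) (snd (snd t)) (fst (fst s)) (snd (fst s))"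
    for n :: nat and s t :: "('a \<times> 'a) \<times> ('a \<times> 'a)"
  have "\<exists>f. \<forall>n. P n (f n) \<and> Q n (f n) (f (Suc n))"
  proof (rule dependent_nat_choice)
    obtain w r p l q where "quad_star v w r p l q" using ex_quad_star[OF assms] by blast
    then show "\<exists>s. P 0 s"
      by (intro exI[of _ "((l, q), (v, w))"]) (auto simp: P_def)
  next
    fix s n assume "P n s"
    then obtain r p where s: "quad_star (fst (snd s)) (snd (snd s)) r p (fst (fst s)) (snd (fst s))"
      by (auto simp: P_def)
    then obtain r' p' where "quad_star r p r' p' (fst (snd s)) (snd (snd s))"
      by (rule quad_star_next)
    with s show "\<exists>t. P (Suc n) t \<and> Q n s t"
      by (intro exI[of _ "(snd s, (r, p))"]) (auto simp: P_def Q_def)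
  qed
  then obtain f where f: "Q n (f n) (f (Suc n))" for n by blast
  have snd_f: "snd (f n) = fst (f (Suc n))" for n using f[of n] by (simp add: Q_def)
  have "quad_ladder K (\<lambda>n. fst (fst (f n))) (\<lambda>n. snd (fst (f n)))"
  proof
    fix n
    show "quad_star (fst (fst (f (Suc n)))) (snd (fst (f (Suc n)))) (fst (fst (f (Suc (Suc n))))) (snd (fst (f (Suc (Suc n)))))
        (fst (fst (f n))) (snd (fst (f n)))"
      using f[of n] unfolding Q_def snd_f by blast
  qed
  then show ?thesis by (rule that)
qed

context quad_ladder begin

definition rung :: "nat \<Rightarrow> 'a set" where
  "rung n = {a n, b n}"

lemma ladder_distinct: "distinct [a n, b n, a (Suc n), b (Suc n), a (Suc (Suc n)), b (Suc (Suc n))]"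
  using ladder_star[of n] by (auto simp: quad_star_def)

text \<open>
  A rung determines its two neighbouring rungs; only the direction of the walk through it is open.
\<close>

lemma rungs_equal_cases:
  assumes "rung (Suc m) = rung (Suc n)"
  obtains (next_next) "rung m = rung n" "rung (Suc (Suc m)) = rung (Suc (Suc n))"
    | (next_prev) "rung m = rung (Suc (Suc n))" "rung (Suc (Suc m)) = rung n"
proof -
  consider "a (Suc m) = a (Suc n)" | "a (Suc m) = b (Suc n)"
    using assms by (auto simp: rung_def doubleton_eq_iff)
  then show ?thesis
  proof cases
    case 1
    show ?thesis
      using quad_star_unique[OF ladder_star[of n] ladder_star[of m, unfolded 1]] next_next next_prev
      by (auto simp: rung_def)
  next
    case 2
    show ?thesis
      using quad_star_unique[OF quad_star_mate[OF ladder_star[of n]] ladder_star[of m, unfolded 2]] next_next next_prev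
      by (auto simp: rung_def insert_commute)
  qed
qed

text \<open>
  A vertex determines the other end of its rung.
\<close>

lemma rungs_meet:
  assumes "rung (Suc m) \<inter> rung (Suc n) \<noteq> {}"
  shows "rung (Suc m) = rung (Suc n)"
proof -
  note n = ladder_star[of n] quad_star_mate[OF ladder_star[of n]]
    and m = ladder_star[of m] quad_star_mate[OF ladder_star[of m]]
  have mate: "w' = w" if "quad_star v w r p l q" "quad_star v w' r' p' l' q'" for v w r p l q w' r' p' l' q'
    using quad_star_unique[OF that] by simp
  consider "a (Suc m) = a (Suc n)" | "a (Suc m) = b (Suc n)" | "b (Suc m) = a (Suc n)" | "b (Suc m) = b (Suc n)"
    using assms by (auto simp: rung_def)
  then show ?thesis
    using mate[OF n(1)] mate[OF n(2)] m unfolding rung_def by cases (metis insert_commute)+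
qed

lemma rung_next: "rung n \<inter> rung (Suc n) = {}" "rung n \<inter> rung (Suc (Suc n)) = {}"
  "rung n \<noteq> rung (Suc n)" "rung n \<noteq> rung (Suc (Suc n))"
  using ladder_distinct[of n] by (auto simp: rung_def)

text \<open>
  The first rung that occurs a second time is rung \<open>1\<close>: the predecessor at a repetition of a later rung
  would be a neighbour of the latter, thus an earlier repetition.  The rung before the return is
  then the neighbour of rung \<open>1\<close> other than rung \<open>2\<close>, namely rung \<open>0\<close>.
\<close>

lemma first_return:
  assumes "finite (vertices K)"
  obtains n where "3 \<le> n" "rung (Suc n) = rung 1" "rung n = rung 0" "inj_on rung {1..n}"
proof -
  have "\<not> inj (\<lambda>n. rung (Suc n))"
  proof
    assume "inj (\<lambda>n. rung (Suc n))"
    moreover have "range (\<lambda>n. rung (Suc n)) \<subseteq> Pow (vertices K)"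
      using quad_star_subset_vertices[OF ladder_star] by (auto simp: rung_def)
    ultimately show False
      using assms by (meson finite_Pow_iff finite_subset range_inj_infinite)
  qed
  then obtain i j where "rung (Suc i) = rung (Suc j)" "i < j"
    unfolding inj_def by (metis nat_neq_iff)
  then have ex: "\<exists>j i. i < j \<and> rung (Suc i) = rung (Suc j)" by blast
  \<comment> \<open>Rung \<open>0\<close> is left out because the walk does not say which rung precedes it.\<close>
  define n where "n = (LEAST j. \<exists>i<j. rung (Suc i) = rung (Suc j))"
  have least: "rung (Suc k) \<noteq> rung (Suc j)" if "j < n" "k < j" for k j
    using not_less_Least[of j "\<lambda>j. \<exists>i<j. rung (Suc i) = rung (Suc j)"] that by (auto simp: n_def)
  obtain i where i: "i < n" "rung (Suc i) = rung (Suc n)"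
    using LeastI_ex[OF ex] unfolding n_def by blast
  have far: "n \<noteq> Suc i" "n \<noteq> Suc (Suc i)"
    using i(2) rung_next[of "Suc i"] by auto
  obtain m where m: "n = Suc m" using i(1) by (cases n) auto
  have im: "Suc i < m" using i(1) far m by simp
  have i0: "i = 0"
  proof (rule ccontr)
    assume "i \<noteq> 0"
    then obtain k where k: "i = Suc k" by (cases i) auto
    have "rung (Suc m) \<in> {rung (Suc k), rung (Suc (Suc i))}"
      using i(2) unfolding m k by (cases rule: rungs_equal_cases) auto
    then show False
      using least[of m k] least[of m "Suc i"] im k m by auto
  qed
  have inj: "inj_on rung {1..n}"
  proof (rule inj_onI)
    fix x y assume xy: "x \<in> {1..n}" "y \<in> {1..n}" "rung x = rung y"
    then show "x = y"
      using least[of "x - 1" "y - 1"] least[of "y - 1" "x - 1"]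
      by (cases x; cases y) (auto, meson linorder_neqE_nat)
  qed
  have second: "rung (Suc (Suc 0)) \<noteq> rung (Suc m)"
    using inj_onD[OF inj, of "Suc (Suc 0)" "Suc m"] im i0 m by auto
  have "rung n = rung 0"
    using i(2)[unfolded i0 m] unfolding m by (cases rule: rungs_equal_cases) (use second in auto)
  with that[of n] inj i i0 im m show ?thesis by auto
qed

text \<open>
  The quadrilaterals at a vertex of one rung end in the preceding and in the following rung, and the
  rungs \<open>0\<close> and \<open>n + 1\<close> coincide with \<open>n\<close> and \<open>1\<close>.
\<close>

lemma ladder_block_closed:
  assumes "rung (Suc n) = rung 1" "rung n = rung 0" "1 \<le> n" "quad_star v w r p l q" "v \<in> \<Union>(rung ` {1..n})"
  shows "{v, w, r, p, l, q} \<subseteq> \<Union>(rung ` {1..n})"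
proof -
  obtain i where i: "v \<in> rung (Suc i)" "Suc i \<le> n"
    using assms(5) by (auto simp: Suc_le_eq gr0_conv_Suc)
  have "{v, w, r, p, l, q} \<subseteq> rung i \<union> rung (Suc i) \<union> rung (Suc (Suc i))"
    using quad_star_unique[OF ladder_star[of i], of w r p l q]
      quad_star_unique[OF quad_star_mate[OF ladder_star[of i]], of w r p l q] i(1) assms(4)
    by (auto simp: rung_def)
  moreover have "rung j \<subseteq> \<Union>(rung ` {1..n})" if "j \<le> Suc n" for j
  proof -
    have "rung j \<in> rung ` {1..n}"
    proof (cases "j = 0 \<or> j = Suc n")
      case True
      then show ?thesis using assms(1-3) by (metis atLeastAtMost_iff image_eqI le_refl)
    qed (use that in auto)
    then show ?thesis by blast
  qed
  from this[of i] this[of "Suc i"] this[of "Suc (Suc i)"]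
  have "rung i \<union> rung (Suc i) \<union> rung (Suc (Suc i)) \<subseteq> \<Union>(rung ` {1..n})"
    using i(2) by simp
  ultimately show ?thesis by (rule subset_trans)
qed

lemma card_ladder_block:
  assumes "inj_on rung {1..n}"
  shows "card (\<Union>(rung ` {1..n})) = 2 * n"
proof -
  have "card (\<Union>(rung ` {1..n})) = (\<Sum>i\<in>{1..n}. card (rung i))"
  proof (rule card_UN_disjoint)
    show "\<forall>i\<in>{1..n}. \<forall>j\<in>{1..n}. i \<noteq> j \<longrightarrow> rung i \<inter> rung j = {}"
    proof (intro ballI impI)
      fix i j assume ij: "i \<in> {1..n}" "j \<in> {1..n}" "i \<noteq> j"
      then have "rung i \<noteq> rung j" using assms by (auto dest: inj_onD)
      then show "rung i \<inter> rung j = {}"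
        using rungs_meet[of "i - 1" "j - 1"] ij by auto
    qed
  qed (auto simp: rung_def)
  also have "\<dots> = (\<Sum>i\<in>{1..n}. 2)"
    using ladder_distinct by (intro sum.cong) (auto simp: rung_def)
  finally show ?thesis by simp
qed

text \<open>
  The complement of the \<open>2 n\<close> vertices of the strip is also closed under adjacency in quadrilaterals,
  and so it is empty or has at least six vertices.  With \<open>n \<ge> 3\<close> this leaves \<open>n = 6\<close>, or \<open>n = 3\<close> and two
  blocks of six vertices.
\<close>

lemma ladder_of_six:
  assumes card: "card (vertices K) = 12"
  shows "rung 7 = rung 1 \<and> rung 6 = rung 0 \<and> inj_on rung {1..6} \<and> vertices K = \<Union>(rung ` {1..6})"
proof -
  have fin: "finite (vertices K)" using card by (auto intro: card_ge_0_finite)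
  obtain n where n: "3 \<le> n" "rung (Suc n) = rung 1" "rung n = rung 0" "inj_on rung {1..n}"
    using first_return[OF fin] .
  define S where "S = \<Union>(rung ` {1..n})"
  have S: "{v, w, r, p, l, q} \<subseteq> S" if "quad_star v w r p l q" "v \<in> S" for v w r p l q
    using ladder_block_closed[OF n(2,3) _ that(1)] that(2) n(1) by (simp add: S_def)
  have sub: "S \<subseteq> vertices K"
  proof -
    have "rung i \<subseteq> vertices K" if "i \<in> {1..n}" for i
      using quad_star_subset_vertices[OF ladder_star[of "i - 1"]] that by (auto simp: rung_def)
    then show ?thesis unfolding S_def by blast
  qed
  have card_S: "card S = 2 * n" unfolding S_def by (rule card_ladder_block[OF n(4)])
  define S' where "S' = vertices K - S"
  have card_S': "card S' = 12 - 2 * n"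
    unfolding S'_def using card_Diff_subset[of S "vertices K"] finite_subset[OF sub fin] sub card card_S by simp
  have S': "{v, w, r, p, l, q} \<subseteq> S'" if star: "quad_star v w r p l q" and "v \<in> S'" for v w r p l q
  proof -
    have "u \<notin> S" if "u \<in> {v, w, r, p, l, q}" for u
    proof
      assume u: "u \<in> S"
      have "cyc [v, r, p, w] \<in> faces_at 4 v" "cyc [v, l, q, w] \<in> faces_at 4 v"
        using star by (simp_all add: quad_star_def)
      then obtain F where F: "F \<in> faces_at 4 u" "v \<in> \<Union>F"
        using faces_at_other[of _ 4 v u] \<open>u \<in> {v, w, r, p, l, q}\<close> Union_cyc
        by (metis insert_iff list.set(1) list.set(2) singletonD)
      obtain w' r' p' l' q' where u': "quad_star u w' r' p' l' q'"
        using ex_quad_star u sub by blast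
      then have "\<Union>F \<subseteq> {u, w', r', p', l', q'}"
        using F(1) Union_cyc[of "[u, r', p', w']"] Union_cyc[of "[u, l', q', w']"] unfolding quad_star_def by auto
      then show False using S[OF u' u] F(2) \<open>v \<in> S'\<close> by (auto simp: S'_def)
    qed
    then show ?thesis using quad_star_subset_vertices[OF star] by (auto simp: S'_def)
  qed
  have "S' = {}"
  proof (rule ccontr)
    assume "S' \<noteq> {}"
    then obtain u where u: "u \<in> S'" by blast
    then have "u \<in> vertices K" by (simp add: S'_def)
    then obtain w r p l q where star: "quad_star u w r p l q"
      using ex_quad_star by blast
    have "card {u, w, r, p, l, q} = 6" using star unfolding quad_star_def by simp
    then have "6 \<le> card S'"
      using card_mono[OF _ S'[OF star u]] fin by (simp add: S'_def)
    then have "n = 3" using card_S' n(1) by simp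
    then have "card S = 6" "card S' = 6" using card_S card_S' by simp_all
    then show False
      using no_six_vertex_block[of S' S u] S S' u sub unfolding S'_def by blast
  qed
  then have "vertices K = S" using sub by (auto simp: S'_def)
  then have "n = 6" using card card_S by simp
  then show ?thesis using n \<open>vertices K = S\<close> by (simp add: S_def)
qed

end

section \<open>Labelling the strip of six quadrilaterals\<close>

text \<open>
  The vertices of a strip of six quadrilaterals are named \<open>0, \<dots>, 11\<close> such that the rungs are the pairs
  \<open>i, i + 6\<close> for \<open>i < 6\<close>.  In an annulus the two sides of the strip are the cycles \<open>0 \<dots> 5\<close> and \<open>6 \<dots> 11\<close>; in
  a Moebius band they join to one cycle \<open>0 \<dots> 11\<close>.  Integers serve as names since evaluation by
  rewriting is fast on their binary numerals.
\<close>

definition opp :: "int \<Rightarrow> int" where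
  "opp i = (if i < 6 then i + 6 else i - 6)"

definition annulus_succ :: "int \<Rightarrow> int" where
  "annulus_succ i = (if i = 5 then 0 else if i = 11 then 6 else i + 1)"

definition annulus_pred :: "int \<Rightarrow> int" where
  "annulus_pred i = (if i = 0 then 5 else if i = 6 then 11 else i - 1)"

definition moebius_succ :: "int \<Rightarrow> int" where
  "moebius_succ i = (if i = 11 then 0 else i + 1)"

definition moebius_pred :: "int \<Rightarrow> int" where
  "moebius_pred i = (if i = 0 then 11 else i - 1)"

lemma labels_eq: "{0..<12::int} = {0, 1, 2, 3, 4, 5, 6, 7, 8, 9, 10, 11}"
  by (rule set_eqI) (simp, presburger)

context quads_and_triangles begin

text \<open>
  The functions \<open>s\<close> and \<open>p\<close> are the steps along the sides of the strip in its two directions.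
\<close>

definition strip_labelling :: "(int \<Rightarrow> 'a) \<Rightarrow> (int \<Rightarrow> int) \<Rightarrow> (int \<Rightarrow> int) \<Rightarrow> bool" where
  "strip_labelling f s p \<longleftrightarrow> bij_betw f {0..<12} (vertices K) \<and>
     (\<forall>i\<in>{0..<12}. s i \<in> {0..<12} \<and> p i \<in> {0..<12} \<and> opp i \<in> {0..<12} \<and>
        quad_star (f i) (f (opp i)) (f (s i)) (f (s (opp i))) (f (p i)) (f (p (opp i))))"

lemma ex_strip_labelling:
  assumes card: "card (vertices K) = 12"
  obtains f where "strip_labelling f annulus_succ annulus_pred \<or> strip_labelling f moebius_succ moebius_pred"
proof -
  obtain v where "v \<in> vertices K" using card by fastforce
  then obtain a b where "quad_ladder K a b" by (rule ex_ladder)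
  then interpret quad_ladder K a b .
  note star = ladder_star
  have suc: "Suc 0 = 1" "Suc 1 = 2" "Suc 2 = 3" "Suc 3 = 4" "Suc 4 = 5" "Suc 5 = 6" "Suc 6 = 7" "Suc 7 = 8"
    by simp_all
  note stars = star[of 0, unfolded suc] star[of 1, unfolded suc] star[of 2, unfolded suc] star[of 3, unfolded suc]
    star[of 4, unfolded suc] star[of 5, unfolded suc] star[of 6, unfolded suc]
  note mates = stars[THEN quad_star_mate]
  have six: "rung 7 = rung 1" "rung 6 = rung 0" "inj_on rung {1..6}"
    "vertices K = \<Union>(rung ` {1..6})"
    using ladder_of_six[OF card] by simp_all
  have not2: "rung 6 \<noteq> rung 2"
    using inj_onD[OF six(3), of 6 2] by auto
  \<comment> \<open>After six steps the walk is back at its first rung, with the two ends in the same order or exchanged.\<close>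
  have ends: "a 7 = a 1 \<and> b 7 = b 1 \<and> a 0 = a 6 \<and> b 0 = b 6 \<or> a 7 = b 1 \<and> b 7 = a 1 \<and> a 0 = b 6 \<and> b 0 = a 6"
  proof -
    consider "a 7 = a 1" | "a 7 = b 1"
      using six(1) by (auto simp: rung_def doubleton_eq_iff)
    then show ?thesis
    proof cases
      case 1
      then show ?thesis
        using quad_star_unique[OF stars(1) stars(7)[unfolded 1]] not2 by (auto simp: rung_def)
    next
      case 2
      then show ?thesis
        using quad_star_unique[OF mates(1) stars(7)[unfolded 2]] not2 by (auto simp: rung_def insert_commute)
    qed
  qed
  define f where "f i = (if i < 6 then a (nat (i + 1)) else b (nat (i - 5)))" for i :: int
  have f: "f 0 = a 1" "f 1 = a 2" "f 2 = a 3" "f 3 = a 4" "f 4 = a 5" "f 5 = a 6"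
    "f 6 = b 1" "f 7 = b 2" "f 8 = b 3" "f 9 = b 4" "f 10 = b 5" "f 11 = b 6"
    by (simp_all add: f_def)
  have "{1..6::nat} = {1, 2, 3, 4, 5, 6}" by auto
  then have im: "f ` {0..<12} = vertices K"
    unfolding six(4) labels_eq by (auto simp: rung_def f)
  have "inj_on f {0..<12}"
    by (rule eq_card_imp_inj_on) (simp_all add: im card)
  then have bij: "bij_betw f {0..<12} (vertices K)"
    using im by (simp add: bij_betw_def)
  from ends show ?thesis
  proof
    assume e: "a 7 = a 1 \<and> b 7 = b 1 \<and> a 0 = a 6 \<and> b 0 = b 6"
    have "strip_labelling f annulus_succ annulus_pred"
      unfolding strip_labelling_def labels_eq using bij[unfolded labels_eq] stars mates e
      by (simp add: f opp_def annulus_succ_def annulus_pred_def)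
    then show ?thesis using that by blast
  next
    assume e: "a 7 = b 1 \<and> b 7 = a 1 \<and> a 0 = b 6 \<and> b 0 = a 6"
    have "strip_labelling f moebius_succ moebius_pred"
      unfolding strip_labelling_def labels_eq using bij[unfolded labels_eq] stars mates e
      by (simp add: f opp_def moebius_succ_def moebius_pred_def)
    then show ?thesis using that by blast
  qed
qed

end

section \<open>Searching for the triangles\<close>

text \<open>
  Triangles are increasing lists, so that equal triangles are equal lists.
\<close>

definition triangle_list :: "int \<Rightarrow> int \<Rightarrow> int \<Rightarrow> int list" where
  "triangle_list a b c = sort [a, b, c]"

definition fan_list :: "(int \<Rightarrow> int) \<Rightarrow> (int \<Rightarrow> int) \<Rightarrow> int \<Rightarrow> int \<Rightarrow> int \<Rightarrow> int \<Rightarrow> int list list" where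
  "fan_list s p i x y z = [triangle_list i (s i) x, triangle_list i x y, triangle_list i y z, triangle_list i z (p i)]"

definition star_labels :: "(int \<Rightarrow> int) \<Rightarrow> (int \<Rightarrow> int) \<Rightarrow> int \<Rightarrow> int list" where
  "star_labels s p i = [i, opp i, s i, p i, s (opp i), p (opp i)]"

text \<open>
  Conditions that the fans at its three vertices impose on a triangle: apart from the ends \<open>s a\<close> and
  \<open>p a\<close>, the fan at \<open>a\<close> avoids the quadrilaterals at \<open>a\<close>, and no triangle joins its two ends.
\<close>

definition admissible :: "(int \<Rightarrow> int) \<Rightarrow> (int \<Rightarrow> int) \<Rightarrow> int list \<Rightarrow> bool" where
  "admissible s p t \<longleftrightarrow> list_all (\<lambda>a. opp a \<notin> set t \<and> s (opp a) \<notin> set t \<and> p (opp a) \<notin> set t \<and>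
     \<not> (s a \<in> set t \<and> p a \<in> set t)) t"

text \<open>
  Testing a triangle as soon as its vertices are chosen keeps the number of candidates down to ten for
  each vertex.
\<close>

definition fan_candidates :: "(int \<Rightarrow> int) \<Rightarrow> (int \<Rightarrow> int) \<Rightarrow> int \<Rightarrow> int list list list" where
  "fan_candidates s p i =
     (let V = filter (\<lambda>x. x \<notin> set (star_labels s p i)) [0..11]
      in [fan_list s p i x y z.
            x \<leftarrow> V, admissible s p (triangle_list i (s i) x),
            y \<leftarrow> V, y \<noteq> x, admissible s p (triangle_list i x y),
            z \<leftarrow> V, z \<noteq> x, z \<noteq> y, admissible s p (triangle_list i y z), admissible s p (triangle_list i z (p i))])"

text \<open>
  A partial solution lists all triangles whose least label is below \<open>i\<close>.  A fan at \<open>i\<close> is compatible with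
  it if the two contain the same triangles among those that have \<open>i\<close> and a smaller label as vertices.
  The head of a triangle is its least label, so what the fan adds are its triangles with head \<open>i\<close>.
\<close>

fun extend :: "int \<Rightarrow> int list list list \<Rightarrow> int list list list \<Rightarrow> int list list list" where
  "extend i fans [] = []"
| "extend i fans (T # Ts) =
     map (\<lambda>ts. filter (\<lambda>t. hd t = i) ts @ T)
       (filter (\<lambda>ts. list_all (\<lambda>t. hd t < i \<longrightarrow> t \<in> set T) ts \<and> list_all (\<lambda>t. i \<in> set t \<longrightarrow> t \<in> set ts) T) fans)
     @ extend i fans Ts"

primrec search :: "(int \<Rightarrow> int) \<Rightarrow> (int \<Rightarrow> int) \<Rightarrow> nat \<Rightarrow> int list list list" where
  "search s p 0 = [[]]"
| "search s p (Suc n) = extend (int n) (fan_candidates s p (int n)) (search s p n)"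

lemma set_triangle_list [simp]: "set (triangle_list a b c) = {a, b, c}"
  unfolding triangle_list_def set_sort by simp

lemma mem_extend:
  assumes "ts \<in> set fans" "T \<in> set Ts" "\<forall>t\<in>set ts. hd t < i \<longrightarrow> t \<in> set T" "\<forall>t\<in>set T. i \<in> set t \<longrightarrow> t \<in> set ts"
  shows "filter (\<lambda>t. hd t = i) ts @ T \<in> set (extend i fans Ts)"
  using assms(2)
proof (induction Ts)
  case (Cons S Ts)
  show ?case
  proof (cases "T = S")
    case True
    then show ?thesis
      using assms(1,3,4) unfolding extend.simps set_append set_map set_filter list_all_iff by blast
  next
    case False
    then show ?thesis using Cons by simp
  qed
qed simp

text \<open>
  After \<open>n\<close> steps one of the partial solutions consists of the triangles of \<open>T\<close> with least label below
  \<open>n\<close>: the fan that \<open>T\<close> has at \<open>n\<close> is compatible with it, and every triangle with least label \<open>n\<close>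
  belongs to that fan.
\<close>

lemma search_complete:
  assumes T: "\<And>t. t \<in> T \<Longrightarrow> t \<noteq> [] \<and> 0 \<le> hd t"
    and fans: "\<And>i. i \<in> {0..<int n} \<Longrightarrow> \<exists>ts\<in>set (fan_candidates s p i). {t \<in> T. i \<in> set t} = set ts"
  shows "\<exists>S\<in>set (search s p n). set S = {t \<in> T. hd t < int n}"
  using fans
proof (induction n)
  case 0
  then show ?case using T by force
next
  case (Suc n)
  have "\<exists>S\<in>set (search s p n). set S = {t \<in> T. hd t < int n}"
    by (rule Suc.IH) (rule Suc.prems, simp)
  then obtain S where S: "S \<in> set (search s p n)" "set S = {t \<in> T. hd t < int n}"
    by blast
  obtain ts where ts: "ts \<in> set (fan_candidates s p (int n))" "{t \<in> T. int n \<in> set t} = set ts"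
    using Suc.prems[of "int n"] by auto
  have "filter (\<lambda>t. hd t = int n) ts @ S \<in> set (search s p (Suc n))"
    unfolding search.simps by (rule mem_extend) (use S ts(1) in \<open>auto simp: ts(2)[symmetric]\<close>)
  moreover have "set (filter (\<lambda>t. hd t = int n) ts @ S) = {t \<in> T. hd t < int (Suc n)}"
  proof -
    have "hd t = int n \<Longrightarrow> int n \<in> set t" if "t \<in> T" for t
      using T[OF that] hd_in_set by metis
    then show ?thesis by (auto simp: S(2) ts(2)[symmetric])
  qed
  ultimately show ?case by blast
qed

text \<open>
  A triangle of \<open>T\<close> belongs to the fans at all its three vertices, so it passes the test of admissibility.
\<close>

lemma fan_candidates_complete:
  assumes fans: "\<And>i. i \<in> {0..<12} \<Longrightarrow> \<exists>x y z. distinct (star_labels s p i @ [x, y, z]) \<and> {x, y, z} \<subseteq> {0..<12} \<and>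
      {t \<in> T. i \<in> set t} = set (fan_list s p i x y z)"
    and T: "\<And>t. t \<in> T \<Longrightarrow> set t \<subseteq> {0..<12}"
    and i: "i \<in> {0..<12}"
  shows "\<exists>ts\<in>set (fan_candidates s p i). {t \<in> T. i \<in> set t} = set ts"
proof -
  have adm: "admissible s p t" if t: "t \<in> T" for t
    unfolding admissible_def list_all_iff
  proof
    fix a assume a: "a \<in> set t"
    then have "a \<in> {0..<12}" using T[OF t] by blast
    then obtain x y z where d: "distinct (star_labels s p a @ [x, y, z])"
      and eq: "{t \<in> T. a \<in> set t} = set (fan_list s p a x y z)"
      using fans by metis
    have "t \<in> set (fan_list s p a x y z)" unfolding eq[symmetric] using t a by simp
    then have "t = triangle_list a (s a) x \<or> t = triangle_list a x y \<or> t = triangle_list a y z \<or> t = triangle_list a z (p a)"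
      by (simp add: fan_list_def)
    then have "set t = {a, s a, x} \<or> set t = {a, x, y} \<or> set t = {a, y, z} \<or> set t = {a, z, p a}"
      by (elim disjE) (simp_all only: set_triangle_list, simp_all)
    then show "opp a \<notin> set t \<and> s (opp a) \<notin> set t \<and> p (opp a) \<notin> set t \<and> \<not> (s a \<in> set t \<and> p a \<in> set t)"
      using d unfolding star_labels_def by (elim disjE) auto
  qed
  obtain x y z where d: "distinct (star_labels s p i @ [x, y, z])" and xyz: "{x, y, z} \<subseteq> {0..<12}"
    and eq: "{t \<in> T. i \<in> set t} = set (fan_list s p i x y z)"
    using fans[OF i] by blast
  have "\<forall>t\<in>set (fan_list s p i x y z). admissible s p t"
    unfolding eq[symmetric] using adm by blast
  then have a: "admissible s p (triangle_list i (s i) x)" "admissible s p (triangle_list i x y)"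
      "admissible s p (triangle_list i y z)" "admissible s p (triangle_list i z (p i))"
    by (simp_all add: fan_list_def)
  have V: "x \<in> {0..11} - set (star_labels s p i)" "y \<in> {0..11} - set (star_labels s p i)" "z \<in> {0..11} - set (star_labels s p i)"
    "x \<noteq> y" "x \<noteq> z" "y \<noteq> z"
    using d xyz by auto
  have "fan_list s p i x y z \<in> set (fan_candidates s p i)"
    unfolding fan_candidates_def Let_def
    using a V by simp (rule bexI[of _ x], rule bexI[of _ y], rule bexI[of _ z], rule refl, simp_all)
  with eq show ?thesis by blast
qed

section \<open>The triangles of the map as a solution of the search\<close>

lemma cyc_map_triangle_list: "cyc (map f (triangle_list a b c)) = cyc [f a, f b, f c]"
  by (simp add: triangle_list_def) (auto simp: cyc_triangle insert_commute)

lemma triangle_list_props: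
  "sorted (triangle_list a b c)" "distinct (triangle_list a b c) \<longleftrightarrow> distinct [a, b, c]"
  "length (triangle_list a b c) = 3"
  unfolding triangle_list_def distinct_sort length_sort by (rule sorted_sort) simp_all

definition annulus_quads :: "int list list" where
  "annulus_quads = map (\<lambda>i. [i, annulus_succ i, annulus_succ (opp i), opp i]) [0..5]"

lemma annulus_quads_complete:
  "list_all (\<lambda>i. canonical_cycle [i, annulus_succ i, annulus_succ (opp i), opp i] \<in> canonical_cycle ` set annulus_quads \<and>
      canonical_cycle [i, annulus_pred i, annulus_pred (opp i), opp i] \<in> canonical_cycle ` set annulus_quads) [0..11]"
  by code_simp

context quads_and_triangles begin

definition labelled_triangles :: "(int \<Rightarrow> 'a) \<Rightarrow> int list set" where
  "labelled_triangles f = {t. sorted t \<and> distinct t \<and> length t = 3 \<and> set t \<subseteq> {0..<12} \<and> cyc (map f t) \<in> K}"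

lemma triangle_list_mem:
  assumes "cyc [f a, f b, f c] \<in> K" "distinct [a, b, c]" "{a, b, c} \<subseteq> {0..<12}"
  shows "triangle_list a b c \<in> labelled_triangles f"
  using assms unfolding labelled_triangles_def mem_Collect_eq cyc_map_triangle_list set_triangle_list
  by (simp add: triangle_list_props)

text \<open>
  The star of a vertex is unique up to its direction, so the fan between the two strip neighbours can be
  read from the successor to the predecessor.
\<close>

lemma labelled_fan:
  assumes f: "strip_labelling f s p" and i: "i \<in> {0..<12}"
  shows "\<exists>x y z. distinct (star_labels s p i @ [x, y, z]) \<and> {x, y, z} \<subseteq> {0..<12} \<and>
      {t \<in> labelled_triangles f. i \<in> set t} = set (fan_list s p i x y z)"
proof -
  have bij: "bij_betw f {0..<12} (vertices K)"
    and lab: "s i \<in> {0..<12}" "p i \<in> {0..<12}"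
    and star: "quad_star (f i) (f (opp i)) (f (s i)) (f (s (opp i))) (f (p i)) (f (p (opp i)))"
    using f i unfolding strip_labelling_def by blast+
  have inj: "inj_on f {0..<12}" using bij by (simp add: bij_betw_def)
  have fi: "f i \<in> vertices K" using bij i by (auto simp: bij_betw_def)
  obtain w r q l q' x y z where star': "quad_star (f i) w r q l q'" and fan: "triangle_fan (f i) l x y z r"
    and disj: "{x, y, z} \<inter> {w, r, q, l, q'} = {}"
    by (rule vertex_star[OF fi]) (rule that)
  have "\<exists>x y z. triangle_fan (f i) (f (s i)) x y z (f (p i)) \<and>
      {x, y, z} \<inter> {f (opp i), f (s i), f (s (opp i)), f (p i), f (p (opp i))} = {}"
    using quad_star_unique[OF star star']
  proof (elim conjE disjE)
    assume "w = f (opp i)" "r = f (s i)" "q = f (s (opp i))" "l = f (p i)" "q' = f (p (opp i))"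
    with fan disj have "triangle_fan (f i) (f (s i)) z y x (f (p i))"
      "{z, y, x} \<inter> {f (opp i), f (s i), f (s (opp i)), f (p i), f (p (opp i))} = {}"
      using triangle_fan_reverse[of "f i" l x y z r] by auto
    then show ?thesis by blast
  next
    assume "w = f (opp i)" "r = f (p i)" "q = f (p (opp i))" "l = f (s i)" "q' = f (s (opp i))"
    with fan disj have "triangle_fan (f i) (f (s i)) x y z (f (p i))"
      "{x, y, z} \<inter> {f (opp i), f (s i), f (s (opp i)), f (p i), f (p (opp i))} = {}"
      by auto
    then show ?thesis by blast
  qed
  then obtain u v w where fan: "triangle_fan (f i) (f (s i)) u v w (f (p i))"
    and disj: "{u, v, w} \<inter> {f (opp i), f (s i), f (s (opp i)), f (p i), f (p (opp i))} = {}"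
    by blast
  have "{u, v, w} \<subseteq> f ` {0..<12}"
    using fan_subset_vertices[OF fan] bij by (auto simp: bij_betw_def)
  then obtain x y z where xyz: "{x, y, z} \<subseteq> {0..<12}" "u = f x" "v = f y" "w = f z"
    by auto
  have fan_d: "distinct [f i, f (s i), f x, f y, f z, f (p i)]"
    and fan_eq: "faces_at 3 (f i) = {cyc [f i, f (s i), f x], cyc [f i, f x, f y], cyc [f i, f y, f z], cyc [f i, f z, f (p i)]}"
    using fan unfolding xyz triangle_fan_def by blast+
  have star_d: "distinct [f i, f (opp i), f (s i), f (s (opp i)), f (p i), f (p (opp i))]"
    using star unfolding quad_star_def by blast
  have d: "distinct (star_labels s p i @ [x, y, z])"
    using star_d fan_d disj unfolding star_labels_def xyz by auto
  have labels: "{i, s i, p i, x, y, z} \<subseteq> {0..<12}" using i lab xyz by simp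
  have d3: "distinct [i, s i, x]" "distinct [i, x, y]" "distinct [i, y, z]" "distinct [i, z, p i]"
    using d by (auto simp: star_labels_def)
  have "t \<in> set (fan_list s p i x y z)" if t: "t \<in> labelled_triangles f" "i \<in> set t" for t
  proof -
    have "card (cyc (map f t)) = 3"
    proof -
      have "distinct (map f t)" "length (map f t) = 3"
        using t(1) inj by (auto simp: labelled_triangles_def distinct_map intro: inj_on_subset)
      then show ?thesis by (metis card_cyc order_refl)
    qed
    then have "cyc (map f t) \<in> faces_at 3 (f i)"
      using t by (simp add: mem_faces_at labelled_triangles_def)
    then have "\<exists>t'\<in>set (fan_list s p i x y z). cyc (map f t) = cyc (map f t')"
      unfolding fan_eq by (auto simp: fan_list_def cyc_map_triangle_list)
    then obtain t' where t': "t' \<in> set (fan_list s p i x y z)" "cyc (map f t) = cyc (map f t')" by blast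
    have t'_cases: "t' = triangle_list i (s i) x \<or> t' = triangle_list i x y \<or> t' = triangle_list i y z \<or> t' = triangle_list i z (p i)"
      using t'(1) by (simp add: fan_list_def)
    then have t'_props: "sorted t'" "distinct t'" "set t' \<subseteq> {0..<12}"
      using d3 labels by (elim disjE; simp add: triangle_list_props)+
    have "f ` set t = f ` set t'"
      using arg_cong[OF t'(2), of Union] by (simp only: Union_cyc set_map)
    then have "set t = set t'"
      using inj_on_image_eq_iff[OF inj] t(1) t'_props(3) by (auto simp: labelled_triangles_def)
    then have "t = t'"
      using sorted_distinct_set_unique t(1) t'_props by (auto simp: labelled_triangles_def)
    then show ?thesis using t'(1) by simp
  qed
  moreover have "t \<in> labelled_triangles f \<and> i \<in> set t" if "t \<in> set (fan_list s p i x y z)" for t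
  proof -
    have in_K: "cyc [f i, f (s i), f x] \<in> K" "cyc [f i, f x, f y] \<in> K" "cyc [f i, f y, f z] \<in> K" "cyc [f i, f z, f (p i)] \<in> K"
      using fan_eq mem_faces_at by blast+
    have "t = triangle_list i (s i) x \<or> t = triangle_list i x y \<or> t = triangle_list i y z \<or> t = triangle_list i z (p i)"
      using that by (simp add: fan_list_def)
    then show ?thesis
      using triangle_list_mem[OF in_K(1) d3(1)] triangle_list_mem[OF in_K(2) d3(2)] triangle_list_mem[OF in_K(3) d3(3)]
        triangle_list_mem[OF in_K(4) d3(4)] labels by (elim disjE) simp_all
  qed
  ultimately have "{t \<in> labelled_triangles f. i \<in> set t} = set (fan_list s p i x y z)" by blast
  with d xyz(1) show ?thesis by blast
qed

lemma labelled_triangles_in_search: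
  assumes f: "strip_labelling f s p"
  obtains S where "S \<in> set (search s p 12)" "set S = labelled_triangles f"
proof -
  let ?T = "labelled_triangles f"
  have T: "set t \<subseteq> {0..<12}" "t \<noteq> []" "hd t \<in> {0..<12}" if "t \<in> ?T" for t
  proof -
    show "set t \<subseteq> {0..<12}" "t \<noteq> []" using that by (auto simp: labelled_triangles_def)
    then show "hd t \<in> {0..<12}" using hd_in_set by blast
  qed
  have "\<exists>S\<in>set (search s p 12). set S = {t \<in> ?T. hd t < int 12}"
  proof (rule search_complete)
    show "\<exists>ts\<in>set (fan_candidates s p i). {t \<in> ?T. i \<in> set t} = set ts" if "i \<in> {0..<int 12}" for i
      by (rule fan_candidates_complete) (use labelled_fan[OF f] T(1) that in auto)
  qed (use T in auto)
  moreover have "{t \<in> ?T. hd t < int 12} = ?T" using T(3) by auto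
  ultimately show ?thesis using that by auto
qed

text \<open>
  Each quadrilateral of the annulus is the one between some label \<open>i < 6\<close> and its successor; the
  quadrilateral seen from a vertex towards its predecessor is the one seen from there in the other direction.
\<close>

lemma annulus_faces:
  assumes f: "strip_labelling f annulus_succ annulus_pred" and S: "set S = labelled_triangles f"
  shows "K = cyc ` map f ` set (annulus_quads @ S)"
proof -
  let ?s = annulus_succ and ?p = annulus_pred
  have bij: "bij_betw f {0..<12} (vertices K)"
    and star: "\<And>i. i \<in> {0..<12} \<Longrightarrow> faces_at 4 (f i) =
      {cyc [f i, f (?s i), f (?s (opp i)), f (opp i)], cyc [f i, f (?p i), f (?p (opp i)), f (opp i)]}"
    using f unfolding strip_labelling_def quad_star_def by blast+
  have "F \<in> cyc ` map f ` set (annulus_quads @ S)" if F: "F \<in> K" for F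
  proof -
    obtain xs where xs: "distinct xs" "3 \<le> length xs" "F = cyc xs"
      using polygon_face[OF F] unfolding polygon_def by blast
    then have "hd xs \<in> \<Union>F" by (cases xs) (auto simp: Union_cyc)
    then obtain v where v: "v \<in> \<Union>F" by blast
    then have vK: "v \<in> vertices K" using F vertices_iff by blast
    then have "v \<in> f ` {0..<12}" using bij by (simp add: bij_betw_def)
    then obtain i where i: "i \<in> {0..<12}" "v = f i" by blast
    have "card F = 3 \<or> card F = 4" by (rule vertex_star[OF vK]) (use F v in blast)
    then show ?thesis
    proof
      assume "card F = 4"
      then have "F \<in> faces_at 4 (f i)" using F v i(2) by (simp add: faces_at_def)
      then have "F = cyc (map f [i, ?s i, ?s (opp i), opp i]) \<or> F = cyc (map f [i, ?p i, ?p (opp i), opp i])"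
        by (simp add: star[OF i(1)])
      moreover have "canonical_cycle [i, ?s i, ?s (opp i), opp i] \<in> canonical_cycle ` set annulus_quads"
          "canonical_cycle [i, ?p i, ?p (opp i), opp i] \<in> canonical_cycle ` set annulus_quads"
        using annulus_quads_complete i(1) unfolding list_all_iff by simp_all
      ultimately have "F \<in> cyc ` map f ` set annulus_quads"
        using cyc_mem_of_canonical_cycle by metis
      then show ?thesis by auto
    next
      assume "card F = 3"
      then obtain u v w where uvw: "distinct [u, v, w]" "F = cyc [u, v, w]"
        using polygon_vertices_of_card_3[OF polygon_face[OF F]] by metis
      have "{u, v, w} \<subseteq> f ` {0..<12}"
        using set_subset_vertices[of "[u, v, w]"] F uvw(2) bij by (simp add: bij_betw_def)
      then obtain a b c where abc: "{a, b, c} \<subseteq> {0..<12}" "u = f a" "v = f b" "w = f c" by auto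
      then have "distinct [a, b, c]" using uvw(1) by auto
      then have "triangle_list a b c \<in> set S"
        using triangle_list_mem[of f a b c] F uvw(2) abc S by simp
      moreover have "F = cyc (map f (triangle_list a b c))"
        by (simp add: cyc_map_triangle_list uvw(2) abc)
      ultimately show ?thesis by auto
    qed
  qed
  moreover have "cyc (map f xs) \<in> K" if "xs \<in> set (annulus_quads @ S)" for xs
  proof (cases "xs \<in> set S")
    case True
    then show ?thesis using S by (simp add: labelled_triangles_def)
  next
    case False
    then obtain i where i: "i \<in> {0..5}" "xs = [i, ?s i, ?s (opp i), opp i]"
      using \<open>xs \<in> set (annulus_quads @ S)\<close> by (auto simp: annulus_quads_def)
    have "cyc [f i, f (?s i), f (?s (opp i)), f (opp i)] \<in> faces_at 4 (f i)"
      using star[of i] i(1) by simp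
    then show ?thesis by (simp add: i(2) mem_faces_at)
  qed
  ultimately show ?thesis by blast
qed

end

lemma isomorphic_mapsI:
  assumes inj: "inj_on h (vertices Y)" and X: "X = (\<lambda>F. (\<lambda>e. h ` e) ` F) ` Y"
  shows "isomorphic_maps X Y"
proof -
  let ?g = "inv_into (vertices Y) h"
  have V: "vertices X = h ` vertices Y"
    unfolding X vertices_def edges_def by auto
  have "?g ` h ` e = e" if "e \<in> F" "F \<in> Y" for e F
  proof -
    have "e \<subseteq> vertices Y" using that by (auto simp: vertices_def edges_def)
    then show ?thesis by (simp add: inj inv_into_image_cancel)
  qed
  then have "(\<lambda>F. (\<lambda>e. ?g ` e) ` F) ` X = (\<lambda>F. F) ` Y"
    unfolding X image_image by (intro image_cong refl) (simp add: image_image cong: image_cong)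
  moreover have "bij_betw ?g (vertices X) (vertices Y)"
    unfolding V using inj by (simp add: bij_betw_inv_into inj_on_imp_bij_betw)
  ultimately show ?thesis unfolding isomorphic_maps_def by auto
qed

text \<open>
  The list \<open>ls\<close> gives at position \<open>v\<close> the label of vertex \<open>v\<close> of the map with faces \<open>ko\<close>.
\<close>

definition relabelling :: "int list \<Rightarrow> nat list list \<Rightarrow> int list list \<Rightarrow> bool" where
  "relabelling ls ko fs \<longleftrightarrow> length ls = 12 \<and> distinct ls \<and> list_all (\<lambda>i. 0 \<le> i \<and> i < 12) ls \<and>
     list_all (list_all (\<lambda>v. v < 12)) ko \<and> same_faces fs (map (map (\<lambda>v. ls ! v)) ko)"

lemma vertices_cyc: "vertices (cyc ` A) = \<Union>(set ` A)"
  unfolding vertices_def edges_def by (auto simp flip: Union_cyc)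

lemma isomorphic_of_relabelling:
  assumes r: "relabelling ls ko fs" and inj: "inj_on f {0..<12::int}"
  shows "isomorphic_maps (cyc ` map f ` set fs) (cyc ` set ko)"
proof (rule isomorphic_mapsI)
  let ?h = "\<lambda>v. f (ls ! v)"
  have ls: "length ls = 12" "distinct ls" "set ls \<subseteq> {0..<12}"
    and ko: "\<Union>(set ` set ko) \<subseteq> {..<12}"
    and same: "same_faces fs (map (map (\<lambda>v. ls ! v)) ko)"
    using r unfolding relabelling_def list_all_iff by auto
  have "inj_on ?h {..<12}"
  proof (rule inj_onI)
    fix u v :: nat assume uv: "u \<in> {..<12}" "v \<in> {..<12}" "f (ls ! u) = f (ls ! v)"
    then have "ls ! u = ls ! v" using inj ls by (auto dest!: inj_onD simp: subset_iff)
    then show "u = v" using uv ls by (simp add: nth_eq_iff_index_eq)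
  qed
  then show "inj_on ?h (vertices (cyc ` set ko))"
    unfolding vertices_cyc using ko by (rule inj_on_subset)
  have "cyc ` map f ` set fs = cyc ` map f ` set (map (map (\<lambda>v. ls ! v)) ko)"
    by (rule same_faces_cyc[OF same])
  also have "\<dots> = (\<lambda>F. (\<lambda>e. ?h ` e) ` F) ` cyc ` set ko"
    by (simp add: image_image cyc_map[symmetric] comp_def)
  finally show "cyc ` map f ` set fs = (\<lambda>F. (\<lambda>e. ?h ` e) ` F) ` cyc ` set ko" .
qed

section \<open>The three maps\<close>

definition KO1_faces :: "nat list list" where
  "KO1_faces = [
     [0,1,8,7], [0,5,6,7], [5,6,11,2], [1,8,10,3], [3,10,9,4], [2,11,9,4],
     [0,4,5], [0,1,2], [0,3,4], [0,2,3], [6,7,9], [7,8,11], [7,9,10], [7,10,11],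
     [2,3,5], [1,3,5], [6,10,11], [6,8,10], [1,4,5], [1,2,4], [6,8,9], [8,9,11]]"

definition KO2_faces :: "nat list list" where
  "KO2_faces = [
     [0,1,8,7], [0,5,6,7], [5,6,11,3], [1,8,10,4], [4,10,9,2], [3,11,9,2],
     [0,4,5], [0,1,2], [0,3,4], [0,2,3], [6,7,9], [7,8,11], [7,9,10], [7,10,11],
     [1,3,4], [1,3,5], [6,10,11], [6,8,10], [2,4,5], [1,2,5], [6,8,9], [8,9,11]]"

definition KNO_faces :: "nat list list" where
  "KNO_faces = [
     [0,1,8,7], [0,5,6,7], [5,6,2,11], [1,8,3,10], [10,3,4,9], [11,2,4,9],
     [0,4,5], [0,1,2], [0,3,4], [0,2,3], [6,7,9], [7,8,11], [7,9,10], [7,10,11],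
     [2,3,6], [3,6,8], [5,10,11], [1,5,10], [1,4,5], [1,2,4], [6,8,9], [8,9,11]]"

lemma KO1_eq: "KO1 = cyc ` set KO1_faces"
  unfolding KO1_def KO1_faces_def list.set by (rule refl)

lemma KO2_eq: "KO2 = cyc ` set KO2_faces"
  unfolding KO2_def KO2_faces_def list.set by (rule refl)

lemma KNO_eq: "KNO = cyc ` set KNO_faces"
  unfolding KNO_def KNO_faces_def list.set by (rule refl)

text \<open>
  On the Moebius band the search dies out: the fans at the first eight vertices cannot be chosen
  compatibly.
\<close>

lemma moebius_search: "search moebius_succ moebius_pred 12 = []"
  by code_simp

text \<open>
  One entry for each solution on the annulus, in the order in which the search finds them.  Solutions
  that belong to the same map differ by a symmetry of the strip.
\<close>

definition annulus_isomorphisms :: "(int list \<times> nat list list) list" where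
  "annulus_isomorphisms = [
     ([10, 9, 6, 8, 7, 11, 5, 4, 3, 1, 2, 0], KO1_faces),
     ([3, 4, 0, 1, 5, 2, 8, 9, 10, 6, 11, 7], KO2_faces),
     ([11, 10, 1, 3, 2, 6, 0, 5, 4, 8, 9, 7], KNO_faces),
     ([9, 10, 6, 7, 11, 8, 2, 3, 4, 0, 5, 1], KO2_faces),
     ([9, 10, 7, 11, 6, 8, 2, 3, 4, 0, 5, 1], KO1_faces),
     ([11, 6, 3, 1, 2, 10, 4, 5, 0, 8, 7, 9], KNO_faces),
     ([10, 9, 0, 2, 1, 11, 5, 4, 3, 7, 8, 6], KNO_faces),
     ([0, 5, 8, 10, 9, 1, 7, 6, 11, 3, 4, 2], KNO_faces),
     ([10, 11, 2, 0, 1, 9, 3, 4, 5, 7, 6, 8], KNO_faces),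
     ([9, 10, 1, 5, 0, 8, 2, 3, 4, 6, 11, 7], KNO_faces)]"

lemma annulus_search:
  "list_all2 (\<lambda>S (ls, ko). relabelling ls ko (annulus_quads @ S))
     (search annulus_succ annulus_pred 12) annulus_isomorphisms"
  by code_simp

section \<open>Orientability\<close>

lemma dcyc_pred_unique:
  assumes "distinct xs" "(u, v) \<in> dcyc xs" "(u', v) \<in> dcyc xs"
  shows "u = u'"
  using assms unfolding dcyc_def by (auto simp: set_zip nth_eq_iff_index_eq)

text \<open>
  Walk along \<open>ys\<close> from the common directed edge.  If the step into a vertex \<open>v\<close> is directed alike in both
  cycles, then so is the step out of \<open>v\<close>: were it reversed in \<open>xs\<close>, then \<open>v\<close> would have two
  predecessors in \<open>xs\<close>, since its neighbours in \<open>ys\<close> are distinct when the length is at least \<open>3\<close>.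
\<close>

lemma dcyc_subset_of_common_edge:
  assumes "distinct xs" "distinct ys" "3 \<le> length ys" "cyc xs = cyc ys"
    and e: "e \<in> dcyc xs" "e \<in> dcyc ys"
  shows "dcyc ys \<subseteq> dcyc xs"
proof -
  let ?n = "length ys"
  obtain j where j: "j < ?n" "e = (ys ! j, ys ! (Suc j mod ?n))"
    using e(2) by (auto simp: dcyc_conv_nth)
  have n: "0 < ?n" using assms(3) by linarith
  have step: "(ys ! ((j + k) mod ?n), ys ! (Suc (j + k) mod ?n)) \<in> dcyc xs" for k
  proof (induction k)
    case 0
    then show ?case using j e by simp
  next
    case (Suc k)
    let ?a = "(j + k) mod ?n" and ?b = "Suc (j + k) mod ?n" and ?c = "Suc (Suc (j + k)) mod ?n"
    have "?a \<noteq> ?c" using assms(3) by (auto simp: mod_Suc split: if_splits)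
    then have ac: "ys ! ?a \<noteq> ys ! ?c" using assms(2) n by (simp add: nth_eq_iff_index_eq)
    have "{ys ! ?b, ys ! ?c} \<in> cyc xs"
      unfolding assms(4) unfolding cyc_conv_nth using mod_less_divisor[OF n]
      by (intro image_eqI[of _ _ ?b]) (simp_all only: mod_Suc_eq lessThan_iff)
    then have "(ys ! ?b, ys ! ?c) \<in> dcyc xs \<or> (ys ! ?c, ys ! ?b) \<in> dcyc xs"
      by (auto simp: cyc_def doubleton_eq_iff)
    then show ?case
      using Suc dcyc_pred_unique[OF assms(1)] ac by auto
  qed
  show ?thesis
  proof
    fix p assume "p \<in> dcyc ys"
    then obtain i where i: "i < ?n" "p = (ys ! i, ys ! (Suc i mod ?n))"
      by (auto simp: dcyc_conv_nth)
    have "(j + (?n - j + i)) mod ?n = i" using i(1) j(1) by simp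
    moreover have "Suc (j + (?n - j + i)) = Suc i + ?n"
      using j(1) by simp
    ultimately show "p \<in> dcyc xs"
      using step[of "?n - j + i"] i(2) by (metis mod_add_self2)
  qed
qed

lemma dcyc_eq_of_common_edge:
  assumes "distinct xs" "3 \<le> length xs" "distinct ys" "3 \<le> length ys" "cyc xs = cyc ys"
    and "e \<in> dcyc xs" "e \<in> dcyc ys"
  shows "dcyc xs = dcyc ys"
  using dcyc_subset_of_common_edge[of xs ys e] dcyc_subset_of_common_edge[of ys xs e] assms by simp

text \<open>
  Two faces with a common edge traverse it in opposite directions as soon as no directed edge is used
  twice.
\<close>

lemma orientableI:
  assumes X: "X = cyc ` set os"
    and polygons: "\<forall>xs\<in>set os. distinct xs \<and> 3 \<le> length xs"
    and opposite: "distinct (concat (map (\<lambda>xs. zip xs (rotate1 xs)) os))"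
  shows "orientable X"
proof -
  \<comment> \<open>A face may be listed more than once, so one of its directed cycles is chosen.\<close>
  define c where "c F = (SOME xs. xs \<in> set os \<and> cyc xs = F)" for F
  have c: "c F \<in> set os" "cyc (c F) = F" if "F \<in> X" for F
    using that someI_ex[of "\<lambda>xs. xs \<in> set os \<and> cyc xs = F"] by (auto simp: X c_def)
  have disj: "dcyc xs \<inter> dcyc ys = {}" if "xs \<in> set os" "ys \<in> set os" "xs \<noteq> ys" for xs ys
  proof -
    have "zip xs (rotate1 xs) \<noteq> zip ys (rotate1 ys)"
    proof
      assume "zip xs (rotate1 xs) = zip ys (rotate1 ys)"
      then have "map fst (zip xs (rotate1 xs)) = map fst (zip ys (rotate1 ys))" by simp
      with that(3) show False by simp
    qed
    then show ?thesis
      using opposite that unfolding distinct_concat_iff dcyc_def by fastforce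
  qed
  show ?thesis
    unfolding orientable_def
  proof (intro exI[of _ "\<lambda>F. dcyc (c F)"] conjI ballI impI)
    fix F assume F: "F \<in> X"
    then show "\<exists>xs. distinct xs \<and> 3 \<le> length xs \<and> F = cyc xs \<and> dcyc (c F) = dcyc xs"
      using c polygons by (intro exI[of _ "c F"]) auto
  next
    fix F G assume "F \<in> X" "G \<in> X" "F \<noteq> G"
    then show "dcyc (c F) \<inter> dcyc (c G) = {}"
      using c by (intro disj) metis+
  qed
qed

text \<open>
  The directed edge \<open>(a, b)\<close> is taken by the first face, so the second one must traverse it as \<open>(b, a)\<close>,
  and one directed edge fixes the direction of the whole cycle.  The vertex \<open>c\<close> shows that the two
  faces are distinct.
\<close>

lemma orientation_across_edge:
  assumes d: "\<forall>F\<in>X. \<exists>xs. distinct xs \<and> 3 \<le> length xs \<and> F = cyc xs \<and> d F = dcyc xs"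
      "\<forall>F\<in>X. \<forall>G\<in>X. F \<noteq> G \<longrightarrow> d F \<inter> d G = {}"
    and dxs: "d (cyc xs) = dcyc xs" "cyc xs \<in> X"
    and ys: "cyc ys \<in> X" "distinct ys" "3 \<le> length ys" and neq: "c \<in> set xs" "c \<notin> set ys"
    and edge: "(a, b) \<in> dcyc xs" "(b, a) \<in> dcyc ys"
  shows "d (cyc ys) = dcyc ys"
proof -
  obtain zs where zs: "distinct zs" "3 \<le> length zs" "cyc ys = cyc zs" "d (cyc ys) = dcyc zs"
    using d(1) ys(1) by blast
  have "cyc xs \<noteq> cyc ys" using neq by (metis Union_cyc)
  then have "(a, b) \<notin> dcyc zs" using d(2) dxs ys(1) edge(1) zs(4) by blast
  moreover have "{b, a} \<in> cyc zs" using edge(2) zs(3)[symmetric] by (force simp: cyc_def)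
  ultimately have "(b, a) \<in> dcyc zs" by (auto simp: cyc_def doubleton_eq_iff)
  then show ?thesis using dcyc_eq_of_common_edge[of zs ys "(b, a)"] zs ys edge by simp
qed

text \<open>
  Reversing all faces turns an orientation into another one, so the direction of one face can be
  prescribed.
\<close>

lemma orientable_extending:
  assumes "orientable X" "cyc xs \<in> X" "distinct xs" "3 \<le> length xs"
  obtains d where "\<forall>F\<in>X. \<exists>ys. distinct ys \<and> 3 \<le> length ys \<and> F = cyc ys \<and> d F = dcyc ys"
      "\<forall>F\<in>X. \<forall>G\<in>X. F \<noteq> G \<longrightarrow> d F \<inter> d G = {}" "d (cyc xs) = dcyc xs"
proof -
  obtain d where d: "\<forall>F\<in>X. \<exists>ys. distinct ys \<and> 3 \<le> length ys \<and> F = cyc ys \<and> d F = dcyc ys"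
      "\<forall>F\<in>X. \<forall>G\<in>X. F \<noteq> G \<longrightarrow> d F \<inter> d G = {}"
    using assms(1)[unfolded orientable_def] by (elim exE conjE) (rule that)
  have rev_ex: "\<exists>ys. distinct ys \<and> 3 \<le> length ys \<and> F = cyc ys \<and> (d F)\<inverse> = dcyc ys" if "F \<in> X" for F
    using d(1) that by (metis cyc_rev dcyc_rev distinct_rev length_rev)
  have rev_disj: "\<forall>F\<in>X. \<forall>G\<in>X. F \<noteq> G \<longrightarrow> (d F)\<inverse> \<inter> (d G)\<inverse> = {}"
    using d(2) by blast
  obtain ys where ys: "distinct ys" "3 \<le> length ys" "cyc xs = cyc ys" "d (cyc xs) = dcyc ys"
    using d(1) assms(2) by blast
  obtain a b where ab: "(a, b) \<in> dcyc xs"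
    using assms(4) by (cases xs) (auto simp: dcyc_conv_nth)
  then have "{a, b} \<in> cyc ys" using ys(3)[symmetric] by (force simp: cyc_def)
  then consider "(a, b) \<in> dcyc ys" | "(a, b) \<in> dcyc (rev ys)"
    by (auto simp: cyc_def doubleton_eq_iff dcyc_rev)
  then show ?thesis
  proof cases
    case 1
    then show ?thesis
      using that[OF d] dcyc_eq_of_common_edge[of xs ys "(a, b)"] assms ys ab by simp
  next
    case 2
    then have "dcyc xs = dcyc (rev ys)"
      using dcyc_eq_of_common_edge[of xs "rev ys" "(a, b)"] assms ys ab cyc_rev[of ys] by simp
    then show ?thesis
      using that[of "\<lambda>F. (d F)\<inverse>"] rev_ex rev_disj ys(4) by (simp add: dcyc_rev)
  qed
qed

lemma orientable_faces:
  assumes "same_faces fs os"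
    and "list_all (\<lambda>xs. distinct xs \<and> 3 \<le> length xs) os"
    and "distinct (concat (map (\<lambda>xs. zip xs (rotate1 xs)) os))"
  shows "orientable (cyc ` set fs)"
  using same_faces_cyc[OF assms(1), of "\<lambda>x. x"] assms(2,3)
  by (intro orientableI[of _ os]) (auto simp: list_all_iff)

lemma orientable_KO1: "orientable KO1"
  unfolding KO1_eq
  by (rule orientable_faces[where os = "[
     [0,1,8,7], [7,6,5,0], [5,6,11,2], [3,10,8,1], [4,9,10,3], [2,11,9,4],
     [5,4,0], [2,1,0], [4,3,0], [3,2,0], [6,7,9], [7,8,11], [10,9,7], [11,10,7],
     [2,3,5], [5,3,1], [6,10,11], [6,8,10], [1,4,5], [1,2,4], [9,8,6], [8,9,11]]"]) code_simp+

lemma orientable_KO2: "orientable KO2"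
  unfolding KO2_eq
  by (rule orientable_faces[where os = "[
     [0,1,8,7], [7,6,5,0], [5,6,11,3], [4,10,8,1], [2,9,10,4], [3,11,9,2],
     [5,4,0], [2,1,0], [4,3,0], [3,2,0], [6,7,9], [7,8,11], [10,9,7], [11,10,7],
     [1,3,4], [5,3,1], [6,10,11], [6,8,10], [2,4,5], [1,2,5], [9,8,6], [8,9,11]]"]) code_simp+

text \<open>
  The faces \<open>0187\<close>, \<open>7650\<close>, \<open>562(11)\<close>, \<open>(11)249\<close>, \<open>421\<close>, \<open>012\<close> and again \<open>0187\<close> form a chain in which
  each face shares an edge with the next.  Carrying the direction of the first face along the chain returns
  it reversed.
\<close>

lemma not_orientable_KNO: "\<not> orientable KNO"
proof
  assume "orientable KNO"
  have face: "cyc xs \<in> KNO" if "canonical_cycle xs \<in> canonical_cycle ` set KNO_faces" for xs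
    using cyc_mem_of_canonical_cycle[OF that, of "\<lambda>v. v"] by (simp add: KNO_eq)
  have faces: "cyc [0,1,8,7] \<in> KNO" "cyc [7,6,5,0] \<in> KNO" "cyc [5,6,2,11] \<in> KNO" "cyc [11,2,4,9] \<in> KNO"
    "cyc [4,2,1] \<in> KNO" "cyc [0,1,2] \<in> KNO" "cyc [7,8,1,0] \<in> KNO"
    by (rule face, code_simp)+
  obtain d where d: "\<forall>F\<in>KNO. \<exists>ys. distinct ys \<and> 3 \<le> length ys \<and> F = cyc ys \<and> d F = dcyc ys"
      "\<forall>F\<in>KNO. \<forall>G\<in>KNO. F \<noteq> G \<longrightarrow> d F \<inter> d G = {}"
    and d0: "d (cyc [0,1,8,7]) = dcyc [0,1,8,7]"
    by (rule orientable_extending[OF \<open>orientable KNO\<close> faces(1)]) auto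
  note step = orientation_across_edge[OF d]
  have "d (cyc [7,6,5,0]) = dcyc [7,6,5,0]"
    by (rule step[OF d0 faces(1,2), of 1 7 0]) (simp_all add: dcyc_def)
  then have "d (cyc [5,6,2,11]) = dcyc [5,6,2,11]"
    by (rule step[OF _ faces(2,3), of 7 6 5]) (simp_all add: dcyc_def)
  then have "d (cyc [11,2,4,9]) = dcyc [11,2,4,9]"
    by (rule step[OF _ faces(3,4), of 5 2 11]) (simp_all add: dcyc_def)
  then have "d (cyc [4,2,1]) = dcyc [4,2,1]"
    by (rule step[OF _ faces(4,5), of 11 2 4]) (simp_all add: dcyc_def)
  then have "d (cyc [0,1,2]) = dcyc [0,1,2]"
    by (rule step[OF _ faces(5,6), of 4 2 1]) (simp_all add: dcyc_def)
  then have "d (cyc [7,8,1,0]) = dcyc [7,8,1,0]"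
    by (rule step[OF _ faces(6,7), of 2 0 1]) (simp_all add: dcyc_def)
  moreover have "cyc [7,8,1,0] = cyc [0,1,8,7::nat]"
    using cyc_rev[of "[0,1,8,7::nat]"] by simp
  moreover have "(0, 1) \<in> dcyc [0,1,8,7::nat]" "(0, 1) \<notin> dcyc [7,8,1,0::nat]"
    by (simp_all add: dcyc_def)
  ultimately show False using d0 by metis
qed

section \<open>The classification\<close>

lemma list_all2_partner: "list_all2 P xs ys \<Longrightarrow> x \<in> set xs \<Longrightarrow> \<exists>y\<in>set ys. P x y"
  by (induction rule: list_all2_induct) auto

theorem theorem1p2:
  shows "(\<forall>K :: 'a face set.
            semi_equivelar_map [(3, 4), (4, 2)] K \<and> card (vertices K) = 12 \<and>
            euler_characteristic K = - 2 \<longrightarrow>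
            isomorphic_maps K KO1 \<or> isomorphic_maps K KO2 \<or> isomorphic_maps K KNO) \<and>
         orientable KO1 \<and> orientable KO2 \<and> \<not> orientable KNO"
proof (intro conjI allI impI orientable_KO1 orientable_KO2 not_orientable_KNO)
  fix K :: "'a face set"
  assume K: "semi_equivelar_map [(3, 4), (4, 2)] K \<and> card (vertices K) = 12 \<and>
    euler_characteristic K = - 2"
  then interpret quads_and_triangles K
    by unfold_locales (simp_all add: semi_equivelar_map_def surface_map_def)
  obtain f where "strip_labelling f annulus_succ annulus_pred \<or> strip_labelling f moebius_succ moebius_pred"
    using ex_strip_labelling K by blast
  then have f: "strip_labelling f annulus_succ annulus_pred"
  proof
    assume "strip_labelling f moebius_succ moebius_pred"
    then obtain S where "S \<in> set (search moebius_succ moebius_pred 12)"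
      by (rule labelled_triangles_in_search)
    then show ?thesis by (simp only: moebius_search list.set empty_iff)
  qed
  then obtain S where S: "S \<in> set (search annulus_succ annulus_pred 12)" "set S = labelled_triangles f"
    by (rule labelled_triangles_in_search)
  obtain q where q: "q \<in> set annulus_isomorphisms" "(case q of (ls, ko) \<Rightarrow> relabelling ls ko (annulus_quads @ S))"
    using list_all2_partner[OF annulus_search S(1)] by blast
  obtain ls ko where "q = (ls, ko)" by (cases q)
  with q have ko: "(ls, ko) \<in> set annulus_isomorphisms" "relabelling ls ko (annulus_quads @ S)"
    by simp_all
  have "inj_on f {0..<12}" using f by (simp add: strip_labelling_def bij_betw_def)
  then have "isomorphic_maps K (cyc ` set ko)"
    using isomorphic_of_relabelling[OF ko(2)] annulus_faces[OF f S(2)] by simp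
  moreover have "ko = KO1_faces \<or> ko = KO2_faces \<or> ko = KNO_faces"
    using ko(1) by (auto simp: annulus_isomorphisms_def)
  ultimately show "isomorphic_maps K KO1 \<or> isomorphic_maps K KO2 \<or> isomorphic_maps K KNO"
    unfolding KO1_eq KO2_eq KNO_eq by blast
qed

end
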